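(* Suppose that there exist a weight function $w:S\to[1,\infty)$ and constants $\rho_1>0$, $b_1\ge 0$, $L>0$ such that (i) $\sum_{j\in S}w(j)q(j|i,a)\le\rho_1w(i)+b_1$ for all $(i,a)\in K$; (ii) $q^*(i)\le Lw(i)$ for all $i\in S$. Then for any $i\in S$, $B\subseteq S$, $\pi\in\Pi$ and $0\le s<t$, ($P_i^\pi$-almost surely) $$P_i^\pi(\xi_t\in B\mid\mathcal{F}_s)=I_{\{\xi_s\in B\}}+E_i^\pi\left[\int_s^t\int_Aq(B|\xi_u,a)\pi(da|\omega,u)\,du\,\bigg|\,\mathcal{F}_s\right],$$ where $q(B|k,a):=\sum_{j\in B}q(j|k,a)$.
   Context: Model. $S$ is a denumerable set (discrete topology), $A$ is a Polish space with Borel $\sigma$-algebra $\mathcal{B}(A)$, and for each $i\in S$, $A(i)\in\mathcal{B}(A)$ is the set of admissible actions in state $i$; $K:=\{(i,a): i\in S, a\in A(i)\}$. The transition rates $q(j|i,a)$ are real numbers, measurable in $a\in A(i)$ for fixed $i,j\in S$, with $q(j|i,a)\ge 0$ for $j\ne i$, $\sum_{j\in S}q(j|i,a)=0$ for all $(i,a)\in K$, and $q^*(i):=\sup_{a\in A(i)}|q(i|i,a)|<\infty$ for all $i\in S$. Path space. $S_\infty:=S\cup\{i_\infty\}$ and $A_\infty:=A\cup\{a_\infty\}$ with isolated points $i_\infty\notin S$, $a_\infty\notin A$; $A(i_\infty):=\{a_\infty\}$ and $q(\cdot|i_\infty,a_\infty):=0$. $\mathbb{R}_+:=(0,\infty)$,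 $\mathbb{R}_+^0:=[0,\infty)$. $\Omega$ is the union of $(S\times\mathbb{R}_+)^\infty$ (sequences $(i_0,\theta_1,i_1,\theta_2,i_2,\ldots)$) and the set of all sequences $(i_0,\theta_1,i_1,\ldots,\theta_{m-1},i_{m-1},\infty,i_\infty,\infty,i_\infty,\ldots)$ with $m\ge1$, $i_l\in S$, $\theta_l\in\mathbb{R}_+$; $\mathcal{F}$ is its Borel $\sigma$-algebra. For $\omega=(i_0,\theta_1,i_1,\ldots)$: $T_0:=0$, $X_m(\omega):=i_m$ $(m\ge 0)$, $\Theta_m(\omega):=\theta_m$, $T_m:=\theta_1+\cdots+\theta_m$ $(m\ge1)$, $T_\infty:=\lim_mT_m$, and $\xi_t:=X_m$ for $T_m\le t<T_{m+1}$, $\xi_t:=i_\infty$ for $t\ge T_\infty$. $\xi_{t-}:=X_m$ for $T_m<t\le T_{m+1}$ with $t<T_\infty$, $\xi_{0-}:=\xi_0$, $\xi_{t-}:=i_\infty$ for $t\ge T_\infty$. $\mathcal{F}_t:=\sigma(\{T_m\le s,X_m=j\}:j\in S,s\le t,m\ge0)$, $\mathcal{F}_{s-}:=\bigvee_{0\le t<s}\mathcal{F}_t$, and $\mathcal{P}:=\sigma(B\times\{0\}\,(B\in\mathcal{F}_0),\ B\times(s,\infty)\,(B\in\mathcal{F}_{s-},s>0))$ is the predictable $\sigma$-algebra on $\Omega\times\mathbb{R}_+^0$. $I_D$ is the indicator of $D$. Policies. $\Pi$ is the set of randomized history-dependent policies: $\mathcal{P}$-measurable transition probabilities $\pi(\cdot|\omega,t)$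 on $(A_\infty,\mathcal{B}(A_\infty))$ concentrated on $A(\xi_{t-}(\omega))$. Probability. For $\pi\in\Pi$ and a probability distribution $\gamma$ on $S$, $P_\gamma^\pi$ is the unique probability measure on $(\Omega,\mathcal{F})$ with $P_\gamma^\pi(\xi_0=i)=\gamma(i)$ for all $i\in S$ and such that, under it, $\nu^\pi(\omega,dt,j):=\left[\int_A\pi(da|\omega,t)q(j|\xi_{t-}(\omega),a)I_{\{j\ne\xi_{t-}(\omega)\}}\right]dt$ is the dual predictable projection (compensator) of the random measure $\mu(\omega,dt,j):=\sum_{m\ge1}I_{\{T_m<\infty\}}I_{\{X_m=j\}}\delta_{T_m}(dt)$ on $\mathbb{R}_+\times S$; the stochastic basis is assumed complete. $P_i^\pi:=P_{\delta_i}^\pi$, with expectation $E_i^\pi$. Integrands at the state $i_\infty$ are taken to be $0$ (immaterial: under the stated hypotheses $i_\infty$ is reached with probability zero). *)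

theory Defs
  imports "HOL-Probability.Probability"
begin

section \<open>The primitive data of the model\<close>

text \<open>
  The state space \<open>S\<close> is the type \<open>'s\<close> and the action space \<open>A\<close> is the type \<open>'a\<close>; \<open>Adm i\<close> is
  \<open>A(i)\<close> and \<open>q j i a\<close> is \<open>q(j|i,a)\<close>. Nothing is assumed about \<open>q j i a\<close> for \<open>a\<close> outside \<open>Adm i\<close>.
\<close>

locale ctmdp_model =
  fixes Adm :: "'s::countable \<Rightarrow> 'a::polish_space set"
    and q :: "'s \<Rightarrow> 's \<Rightarrow> 'a \<Rightarrow> real"
  assumes Adm_measurable: "\<And>i. Adm i \<in> sets borel"
    and rate_measurable: "\<And>i j. q j i \<in> borel_measurable (restrict_space borel (Adm i))"
    and rate_nonneg: "\<And>i j a. a \<in> Adm i \<Longrightarrow> j \<noteq> i \<Longrightarrow> 0 \<le> q j i a"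
    and rate_conservative: "\<And>i a. a \<in> Adm i \<Longrightarrow> ((\<lambda>j. q j i a) has_sum 0) UNIV"
    and rate_stable: "\<And>i. bdd_above ((\<lambda>a. \<bar>q i i a\<bar>) ` Adm i)"

definition qstar :: "('s \<Rightarrow> 'a set) \<Rightarrow> ('s \<Rightarrow> 's \<Rightarrow> 'a \<Rightarrow> real) \<Rightarrow> 's \<Rightarrow> real" where
  "qstar Adm q i = (SUP a\<in>Adm i. \<bar>q i i a\<bar>)"

text \<open>
  The adjoined points \<open>i\<^sub>\<infinity>\<close> and \<open>a\<^sub>\<infinity>\<close> are both rendered as \<^const>\<open>None\<close>. As \<open>a\<^sub>\<infinity>\<close> is isolated,
  a set is open in \<open>A\<^sub>\<infinity>\<close> iff its trace on \<open>A\<close> is open.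
\<close>

definition borel_infty :: "'a::topological_space option measure" where
  "borel_infty = sigma UNIV {U. open {a. Some a \<in> U}}"

definition Adm_infty :: "('s \<Rightarrow> 'a set) \<Rightarrow> 's option \<Rightarrow> 'a option set" where
  "Adm_infty Adm k = (case k of Some i \<Rightarrow> Some ` Adm i | None \<Rightarrow> {None})"

text \<open>
  The rates on all of \<open>S\<^sub>\<infinity> \<times> A\<^sub>\<infinity>\<close>. They vanish at \<open>i\<^sub>\<infinity>\<close> and \<open>a\<^sub>\<infinity>\<close>; the value \<open>0\<close> at the other
  inadmissible pairs is a convention which makes the rates total and measurable in the action.
  Hence integrals over \<open>A\<close> can be taken over \<open>A\<^sub>\<infinity>\<close>.
\<close>

definition rate :: "('s \<Rightarrow> 'a set) \<Rightarrow> ('s \<Rightarrow> 's \<Rightarrow> 'a \<Rightarrow> real)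
    \<Rightarrow> 's \<Rightarrow> 's option \<Rightarrow> 'a option \<Rightarrow> real" where
  "rate Adm q j k a =
     (case (k, a) of (Some i, Some c) \<Rightarrow> if c \<in> Adm i then q j i c else 0 | _ \<Rightarrow> 0)"

definition rate_set :: "('s \<Rightarrow> 'a set) \<Rightarrow> ('s \<Rightarrow> 's \<Rightarrow> 'a \<Rightarrow> real)
    \<Rightarrow> 's set \<Rightarrow> 's option \<Rightarrow> 'a option \<Rightarrow> real" where
  "rate_set Adm q B k a = (\<Sum>\<^sub>\<infinity>j\<in>B. rate Adm q j k a)"


section \<open>Path space\<close>

text \<open>A sequence \<open>(i\<^sub>0, \<theta>\<^sub>1, i\<^sub>1, \<theta>\<^sub>2, \<dots>)\<close> is the pair of \<open>(i\<^sub>0, i\<^sub>1, \<dots>)\<close> and \<open>(\<theta>\<^sub>1, \<theta>\<^sub>2, \<dots>)\<close>.\<close>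

type_synonym 's path = "(nat \<Rightarrow> 's option) \<times> (nat \<Rightarrow> ennreal)"

definition X :: "nat \<Rightarrow> 's path \<Rightarrow> 's option" where
  "X m \<omega> = fst \<omega> m"

text \<open>\<open>\<Theta>\<close> is meant for \<open>m \<ge> 1\<close> only; the second component of a path starts with \<open>\<theta>\<^sub>1\<close>.\<close>

definition \<Theta> :: "nat \<Rightarrow> 's path \<Rightarrow> ennreal" where
  "\<Theta> m \<omega> = snd \<omega> (m - 1)"

definition T :: "nat \<Rightarrow> 's path \<Rightarrow> ennreal" where
  "T m \<omega> = (\<Sum>l=1..m. \<Theta> l \<omega>)"

definition T_infty :: "'s path \<Rightarrow> ennreal" where
  "T_infty \<omega> = lim (\<lambda>m. T m \<omega>)"

definition Omega :: "'s path set" where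
  "Omega =
     {\<omega>. (\<forall>l. X l \<omega> \<noteq> None) \<and> (\<forall>l\<ge>1. 0 < \<Theta> l \<omega> \<and> \<Theta> l \<omega> < \<infinity>)} \<union>
     {\<omega>. \<exists>m\<ge>1. (\<forall>l<m. X l \<omega> \<noteq> None) \<and> (\<forall>l\<in>{1..<m}. 0 < \<Theta> l \<omega> \<and> \<Theta> l \<omega> < \<infinity>)
           \<and> (\<forall>l\<ge>m. \<Theta> l \<omega> = \<infinity> \<and> X l \<omega> = None)}"

text \<open>
  All factors are second countable, so the Borel sets of \<open>\<Omega>\<close> are the traces of the product
  sigma-algebra.
\<close>

definition path_space :: "'s path measure" where
  "path_space = restrict_space
     ((\<Pi>\<^sub>M l\<in>UNIV. count_space UNIV) \<Otimes>\<^sub>M (\<Pi>\<^sub>M l\<in>UNIV. borel)) Omega"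

definition \<xi> :: "real \<Rightarrow> 's path \<Rightarrow> 's option" where
  "\<xi> t \<omega> =
     (if ennreal t < T_infty \<omega>
      then X (THE m. T m \<omega> \<le> ennreal t \<and> ennreal t < T (Suc m) \<omega>) \<omega>
      else None)"

definition \<xi>_minus :: "real \<Rightarrow> 's path \<Rightarrow> 's option" where
  "\<xi>_minus t \<omega> =
     (if t = 0 then \<xi> 0 \<omega>
      else if ennreal t < T_infty \<omega>
      then X (THE m. T m \<omega> < ennreal t \<and> ennreal t \<le> T (Suc m) \<omega>) \<omega>
      else None)"

definition \<F> :: "real \<Rightarrow> 's path measure" where
  "\<F> t = sigma Omega
     {{\<omega> \<in> Omega. T m \<omega> \<le> ennreal s \<and> X m \<omega> = Some j} | m s j. 0 \<le> s \<and> s \<le> t}"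


section \<open>Predictability and policies\<close>

text \<open>
  The filtration is a parameter: policies are predictable for \<^const>\<open>\<F>\<close>, whereas the compensator
  refers to the completed stochastic basis.
\<close>

definition left_limit_sets :: "(real \<Rightarrow> 's path measure) \<Rightarrow> real \<Rightarrow> 's path set set" where
  "left_limit_sets G s = sigma_sets Omega (\<Union>t\<in>{0..<s}. sets (G t))"

definition predictable :: "(real \<Rightarrow> 's path measure) \<Rightarrow> ('s path \<times> real) measure" where
  "predictable G = sigma (Omega \<times> {0..})
     ({B \<times> {0} | B. B \<in> sets (G 0)} \<union> {B \<times> {s<..} | B s. 0 < s \<and> B \<in> left_limit_sets G s})"

definition policies ::
  "('s \<Rightarrow> 'a::topological_space set) \<Rightarrow> ('s path \<Rightarrow> real \<Rightarrow> 'a option measure) set" where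
  "policies Adm =
     {\<pi>. (\<lambda>(\<omega>, t). \<pi> \<omega> t) \<in> predictable \<F> \<rightarrow>\<^sub>M prob_algebra borel_infty
        \<and> (\<forall>\<omega>\<in>Omega. \<forall>t\<ge>0. emeasure (\<pi> \<omega> t) (Adm_infty Adm (\<xi>_minus t \<omega>)) = 1)}"


section \<open>Random measures and the law of the process\<close>

text \<open>Lebesgue measure on \<open>(0,\<infinity>)\<close> times counting measure on \<open>S\<close>.\<close>

definition mark_space :: "(real \<times> 's) measure" where
  "mark_space = restrict_space lborel {0<..} \<Otimes>\<^sub>M count_space UNIV"

text \<open>
  The image of counting measure is the sum of the Dirac measures at the points
  \<open>(T\<^sub>m, X\<^sub>m)\<close> with \<open>m \<ge> 1\<close>, \<open>T\<^sub>m < \<infinity>\<close> and \<open>X\<^sub>m \<in> S\<close>.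
\<close>

definition jump_measure :: "'s path \<Rightarrow> (real \<times> 's) measure" where
  "jump_measure \<omega> =
     distr (count_space {m. 1 \<le> m \<and> T m \<omega> < \<infinity> \<and> X m \<omega> \<noteq> None}) mark_space
       (\<lambda>m. (enn2real (T m \<omega>), the (X m \<omega>)))"

definition policy_compensator ::
  "('s \<Rightarrow> 'a set) \<Rightarrow> ('s \<Rightarrow> 's \<Rightarrow> 'a \<Rightarrow> real) \<Rightarrow> ('s path \<Rightarrow> real \<Rightarrow> 'a option measure)
     \<Rightarrow> 's path \<Rightarrow> (real \<times> 's) measure" where
  "policy_compensator Adm q \<pi> \<omega> = density mark_space
     (\<lambda>(t, j). \<integral>\<^sup>+ a. ennreal (rate Adm q j (\<xi>_minus t \<omega>) a)
                    * indicator {k. k \<noteq> \<xi>_minus t \<omega>} (Some j) \<partial>\<pi> \<omega> t)"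

text \<open>
  \<open>\<nu>\<close> is a predictable random measure if integrating a nonnegative predictable function over
  \<open>(0,t] \<times> S\<close> yields a predictable process in \<open>t\<close>. The dual predictable projection of \<open>\<mu>\<close> is the
  predictable random measure that has the same expected integrals of such functions as \<open>\<mu>\<close>.
\<close>

definition predictable_random_measure ::
  "(real \<Rightarrow> 's path measure) \<Rightarrow> ('s path \<Rightarrow> (real \<times> 's) measure) \<Rightarrow> bool" where
  "predictable_random_measure G \<nu> \<longleftrightarrow>
     (\<forall>\<omega>\<in>Omega. sets (\<nu> \<omega>) = sets mark_space) \<and>
     (\<forall>Y \<in> borel_measurable (predictable G \<Otimes>\<^sub>M count_space UNIV).
        (\<lambda>(\<omega>, t). \<integral>\<^sup>+ (u, j). (Y ((\<omega>, u), j) :: ennreal) * indicator {0<..t} u \<partial>\<nu> \<omega>)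
          \<in> borel_measurable (predictable G))"

definition dual_predictable_projection ::
  "'s path measure \<Rightarrow> (real \<Rightarrow> 's path measure) \<Rightarrow> ('s path \<Rightarrow> (real \<times> 's) measure)
     \<Rightarrow> ('s path \<Rightarrow> (real \<times> 's) measure) \<Rightarrow> bool" where
  "dual_predictable_projection P G \<mu> \<nu> \<longleftrightarrow>
     predictable_random_measure G \<nu> \<and>
     (\<forall>Y \<in> borel_measurable (predictable G \<Otimes>\<^sub>M count_space UNIV).
        (\<integral>\<^sup>+ \<omega>. (\<integral>\<^sup>+ (u, j). (Y ((\<omega>, u), j) :: ennreal) \<partial>\<mu> \<omega>) \<partial>P) =
        (\<integral>\<^sup>+ \<omega>. (\<integral>\<^sup>+ (u, j). Y ((\<omega>, u), j) \<partial>\<nu> \<omega>) \<partial>P))"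

definition completed_filtration :: "'s path measure \<Rightarrow> real \<Rightarrow> 's path measure" where
  "completed_filtration P t = sigma Omega (sets (\<F> t) \<union> null_sets (completion P))"

text \<open>
  The defining property of \<open>P\<^sub>\<gamma>\<^sup>\<pi>\<close> as a measure on the uncompleted path space; its stochastic basis
  consists of \<^term>\<open>completion P\<close> and \<^term>\<open>completed_filtration P\<close>.
\<close>

definition policy_law ::
  "('s \<Rightarrow> 'a set) \<Rightarrow> ('s \<Rightarrow> 's \<Rightarrow> 'a \<Rightarrow> real) \<Rightarrow> ('s path \<Rightarrow> real \<Rightarrow> 'a option measure)
     \<Rightarrow> 's pmf \<Rightarrow> 's path measure \<Rightarrow> bool" where
  "policy_law Adm q \<pi> \<gamma> P \<longleftrightarrow>
     prob_space P \<and> sets P = sets path_space \<and>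
     (\<forall>i. measure P {\<omega> \<in> Omega. \<xi> 0 \<omega> = Some i} = pmf \<gamma> i) \<and>
     dual_predictable_projection (completion P) (completed_filtration P)
       jump_measure (policy_compensator Adm q \<pi>)"

end

theory Submission
  imports Defs
begin

text \<open>
  The compensator formula turns expected sums over jumps into expected time integrals. With
  \<open>\<alpha> = \<rho>\<^sub>1 + b\<^sub>1 + 1\<close>, put \<open>a\<^sub>m = E[exp (- \<alpha> T\<^sub>m) w(X\<^sub>m)]\<close> and let \<open>S\<^sub>m\<close> be the expectation of the integral of
  \<open>exp (- \<alpha> u) w(X\<^sub>m)\<close> over the sojourn interval \<open>(T\<^sub>m, T\<^sub>m\<^sub>+\<^sub>1]\<close>. Applying the formula on this interval to
  \<open>exp (- \<alpha> u) w(j)\<close> and to \<open>exp (- \<alpha> u) w(X\<^sub>m)\<close>, the drift condition gives \<open>a\<^sub>m\<^sub>+\<^sub>1 + S\<^sub>m \<le> a\<^sub>m\<close>; here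
  all terms are nonnegative, so no integrability has to be known beforehand. Hence \<open>\<Sum>\<^sub>m S\<^sub>m \<le> w(i)\<close>,
  which makes the jump rates integrable on bounded time intervals and, through
  \<open>E[\<Sum>\<^sub>m exp (- \<alpha> T\<^sub>m\<^sub>+\<^sub>1)] \<le> L \<Sum>\<^sub>m S\<^sub>m\<close>, excludes explosion. On a nonexplosive path the increment of
  \<open>I\<^sub>B(\<xi>)\<close> over \<open>(s, t]\<close> is the number of jumps into \<open>B\<close> minus the number of jumps out of \<open>B\<close>, and the
  compensator formula for these two counts, restricted to an event of the past of \<open>s\<close>, is the claim.
\<close>

section \<open>Paths\<close>

text \<open>The obstacle is that weight times exit rate can be of order w^2, whose expectation
  nothing controls in advance, so the diagonal part of the drift condition may not be subtracted.
  Cutting the path at its jump times avoids this: a sojourn interval is predictable and contains no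
  jump time except its right end, so the formula on it links the weight of one state with that of
  the next, and the recursion starts from the finite number w(i). The discount yields \<alpha>
  copies of the sojourn weight, the drift consumes all but one, and this surplus is what gets
  summed. The integrands also have to be matched. The compensator involves the left limit and
  nonnegative off-diagonal rates, the claim involves the state itself and the signed q(B|k,a). The
  sign of q(B|k,a) depends only on whether k lies in B, so it splits into a flow into B from outside
  and a flow out of B from inside; the left limit differs from the state only on a Lebesgue null set
  of times. The two flows are subtracted only after both are known to have finite
  expectation.\<close>

lemma T_0 [simp]: "T 0 \<omega> = 0"
  by (simp add: T_def)

lemma T_Suc: "T (Suc m) \<omega> = T m \<omega> + \<Theta> (Suc m) \<omega>"
  by (simp add: T_def)

lemma incseq_T: "incseq (\<lambda>m. T m \<omega>)"
  by (rule incseq_SucI) (simp add: T_Suc)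

lemma T_mono: "m \<le> n \<Longrightarrow> T m \<omega> \<le> T n \<omega>"
  using incseq_T by (rule incseqD)

lemma T_infty_eq_SUP: "T_infty \<omega> = (SUP m. T m \<omega>)"
  unfolding T_infty_def by (intro limI LIMSEQ_SUP incseq_T)

lemma T_le_T_infty: "T m \<omega> \<le> T_infty \<omega>"
  unfolding T_infty_eq_SUP by (rule SUP_upper) simp

lemma Omega_cases:
  assumes "\<omega> \<in> Omega"
  obtains (infinite) "\<forall>l. X l \<omega> \<noteq> None" "\<forall>l\<ge>1. 0 < \<Theta> l \<omega> \<and> \<Theta> l \<omega> < \<infinity>"
  | (absorbed) m where "m \<ge> 1" "\<forall>l<m. X l \<omega> \<noteq> None" "\<forall>l\<in>{1..<m}. 0 < \<Theta> l \<omega> \<and> \<Theta> l \<omega> < \<infinity>"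
      "\<forall>l\<ge>m. \<Theta> l \<omega> = \<infinity> \<and> X l \<omega> = None"
  using assms unfolding Omega_def Un_iff mem_Collect_eq by (elim disjE exE conjE)

lemma Theta_pos:
  assumes "\<omega> \<in> Omega" "1 \<le> m"
  shows "0 < \<Theta> m \<omega>"
  using assms(1)
proof (cases rule: Omega_cases)
  case infinite
  then show ?thesis
    using assms(2) by simp
next
  case (absorbed n)
  then show ?thesis
    using assms(2) by (cases "m < n") auto
qed

text \<open>On an absorbed path the infinite holding times start at the very index from which the
  states are \<open>None\<close>. Hence a finite jump time always carries a genuine state, and
  \<open>enn2real (T m \<omega>)\<close> and \<open>the (X m \<omega>)\<close> are meaningful
  together.\<close>

lemma T_eq_infty_iff:
  assumes "\<omega> \<in> Omega"
  shows "T m \<omega> = \<infinity> \<longleftrightarrow> X m \<omega> = None"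
  using assms
proof (cases rule: Omega_cases)
  case infinite
  then have "T m \<omega> < \<infinity>"
    by (simp add: T_def)
  then have "T m \<omega> \<noteq> \<infinity>"
    by simp
  then show ?thesis
    using infinite(1) by simp
next
  case (absorbed n)
  show ?thesis
  proof (cases "m < n")
    case True
    then have "T m \<omega> < \<infinity>"
      using absorbed(3) by (simp add: T_def)
    then have "T m \<omega> \<noteq> \<infinity>"
      by simp
    then show ?thesis
      using absorbed(2) True by simp
  next
    case False
    then have "\<Theta> m \<omega> \<le> T m \<omega>"
      unfolding T_def using absorbed(1) by (intro member_le_sum) auto
    then have "T m \<omega> = \<infinity>"
      using absorbed(4) False by (simp add: top_unique)
    then show ?thesis
      using absorbed(4) False by simp
  qed
qed

lemma T_less_T_Suc:
  assumes "\<omega> \<in> Omega" "T m \<omega> < \<infinity>"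
  shows "T m \<omega> < T (Suc m) \<omega>"
proof -
  have "T m \<omega> + 0 < T m \<omega> + \<Theta> (Suc m) \<omega>"
    using assms Theta_pos[of \<omega> "Suc m"]
    by (simp add: ennreal_add_left_cancel_less)
  then show ?thesis
    by (simp add: T_Suc)
qed

lemma T_strict_mono:
  assumes "\<omega> \<in> Omega" "m < n" "T m \<omega> < \<infinity>"
  shows "T m \<omega> < T n \<omega>"
proof -
  have "T m \<omega> < T (Suc m) \<omega>"
    using assms(1,3) by (rule T_less_T_Suc)
  also have "\<dots> \<le> T n \<omega>"
    using assms(2) by (intro T_mono) simp
  finally show ?thesis .
qed

text \<open>The next holding time is positive, so a finite jump time lies strictly before explosion;
  if \<open>T m \<omega>\<close> is infinite, so is \<open>T_infty \<omega>\<close>. Thus the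
  \<open>None\<close> branch of \<open>\<xi>_minus\<close> is never taken on an interval ending at a
  jump time, not even at its right end.\<close>

lemma le_T_imp_less_T_infty:
  assumes "\<omega> \<in> Omega" "ennreal u \<le> T m \<omega>"
  shows "ennreal u < T_infty \<omega>"
proof (cases "T m \<omega> = \<infinity>")
  case True
  then show ?thesis
    using T_le_T_infty[of m \<omega>] by (simp add: top_unique)
next
  case False
  then have "T m \<omega> < T (Suc m) \<omega>"
    using assms by (intro T_less_T_Suc) (auto simp: less_top)
  also have "\<dots> \<le> T_infty \<omega>"
    by (rule T_le_T_infty)
  finally show ?thesis
    using assms by simp
qed

lemma less_T_infty_imp_less_T: "ennreal u < T_infty \<omega> \<Longrightarrow> \<exists>m. ennreal u < T m \<omega>"
  unfolding T_infty_eq_SUP by (simp add: less_SUP_iff)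

lemma T_interval_unique:
  assumes "T m \<omega> < x" "x \<le> T (Suc m) \<omega>" "T n \<omega> < x" "x \<le> T (Suc n) \<omega>"
  shows "m = n"
proof (rule ccontr)
  assume "m \<noteq> n"
  then consider "Suc m \<le> n" | "Suc n \<le> m" by linarith
  then show False
    using T_mono[of "Suc m" n \<omega>] T_mono[of "Suc n" m \<omega>] assms by cases (auto simp: not_le[symmetric])
qed

lemma T_interval_unique':
  assumes "T m \<omega> \<le> x" "x < T (Suc m) \<omega>" "T n \<omega> \<le> x" "x < T (Suc n) \<omega>"
  shows "m = n"
proof (rule ccontr)
  assume "m \<noteq> n"
  then consider "Suc m \<le> n" | "Suc n \<le> m" by linarith
  then show False
    using T_mono[of "Suc m" n \<omega>] T_mono[of "Suc n" m \<omega>] assms by cases (auto simp: not_le[symmetric])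
qed

lemma \<xi>_minus_eq:
  assumes "\<omega> \<in> Omega" "T m \<omega> < ennreal u" "ennreal u \<le> T (Suc m) \<omega>"
  shows "\<xi>_minus u \<omega> = X m \<omega>"
proof -
  have "u \<noteq> 0"
    using assms(2) by auto
  moreover have "(THE n. T n \<omega> < ennreal u \<and> ennreal u \<le> T (Suc n) \<omega>) = m"
    using assms T_interval_unique by (intro the_equality) blast+
  ultimately show ?thesis
    using le_T_imp_less_T_infty[OF assms(1,3)] by (simp add: \<xi>_minus_def)
qed

lemma \<xi>_eq:
  assumes "T m \<omega> \<le> ennreal u" "ennreal u < T (Suc m) \<omega>"
  shows "\<xi> u \<omega> = X m \<omega>"
proof -
  have "(THE n. T n \<omega> \<le> ennreal u \<and> ennreal u < T (Suc n) \<omega>) = m"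
    using assms T_interval_unique' by (intro the_equality) blast+
  moreover have "ennreal u < T_infty \<omega>"
    using assms(2) T_le_T_infty[of "Suc m" \<omega>] by simp
  ultimately show ?thesis
    by (simp add: \<xi>_def)
qed

lemma ex_T_interval:
  assumes "0 < u" "ennreal u < T_infty \<omega>"
  shows "\<exists>m. T m \<omega> < ennreal u \<and> ennreal u \<le> T (Suc m) \<omega>"
proof -
  obtain n where "ennreal u \<le> T n \<omega>"
    using less_T_infty_imp_less_T[OF assms(2)] less_imp_le by blast
  \<comment> \<open>The least index whose jump time reaches u is not 0, because \<open>T 0\<close>
    is 0 and u is positive; its predecessor is the index sought.\<close>
  then have "\<exists>n. \<not> ennreal u \<le> T n \<omega> \<and> ennreal u \<le> T (Suc n) \<omega>"
    using ex_least_nat_less[of "\<lambda>n. ennreal u \<le> T n \<omega>" n] assms(1) by auto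
  then show ?thesis
    by (auto simp: not_le)
qed

lemma ex_T_interval':
  assumes "ennreal u < T_infty \<omega>"
  shows "\<exists>m. T m \<omega> \<le> ennreal u \<and> ennreal u < T (Suc m) \<omega>"
proof -
  obtain n where "ennreal u < T n \<omega>"
    using less_T_infty_imp_less_T[OF assms] by blast
  then have "\<exists>n. \<not> ennreal u < T n \<omega> \<and> ennreal u < T (Suc n) \<omega>"
    using ex_least_nat_less[of "\<lambda>n. ennreal u < T n \<omega>" n] by auto
  then show ?thesis
    by (auto simp: not_less)
qed

lemma \<xi>_minus_eq_Some_iff:
  assumes "\<omega> \<in> Omega" "0 < u"
  shows "\<xi>_minus u \<omega> = Some k \<longleftrightarrow>
    (\<exists>m. T m \<omega> < ennreal u \<and> ennreal u \<le> T (Suc m) \<omega> \<and> X m \<omega> = Some k)"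
proof
  assume *: "\<xi>_minus u \<omega> = Some k"
  then have "ennreal u < T_infty \<omega>"
    using assms by (auto simp: \<xi>_minus_def split: if_splits)
  with ex_T_interval[OF assms(2)] show "\<exists>m. T m \<omega> < ennreal u \<and> ennreal u \<le> T (Suc m) \<omega> \<and> X m \<omega> = Some k"
    using \<xi>_minus_eq[OF assms(1)] * by metis
qed (use \<xi>_minus_eq[OF assms(1)] in auto)

lemma \<xi>_eq_Some_iff:
  "\<xi> u \<omega> = Some k \<longleftrightarrow> (\<exists>m. T m \<omega> \<le> ennreal u \<and> ennreal u < T (Suc m) \<omega> \<and> X m \<omega> = Some k)"
proof
  assume *: "\<xi> u \<omega> = Some k"
  then have "ennreal u < T_infty \<omega>"
    by (auto simp: \<xi>_def split: if_splits)
  with ex_T_interval' show "\<exists>m. T m \<omega> \<le> ennreal u \<and> ennreal u < T (Suc m) \<omega> \<and> X m \<omega> = Some k"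
    using \<xi>_eq * by metis
qed (metis \<xi>_eq)

lemma \<xi>_0: "\<omega> \<in> Omega \<Longrightarrow> \<xi> 0 \<omega> = X 0 \<omega>"
  using T_less_T_Suc[of \<omega> 0] by (intro \<xi>_eq) auto

text \<open>The compensator is written with the left limit, the theorem with the state itself. The
  excluded times form a countable set, so the two can be exchanged under a Lebesgue integral. From
  explosion on both are \<open>None\<close>.\<close>

lemma \<xi>_eq_\<xi>_minus:
  assumes "\<omega> \<in> Omega" "0 < u" "u \<notin> range (\<lambda>m. enn2real (T m \<omega>))"
  shows "\<xi> u \<omega> = \<xi>_minus u \<omega>"
proof (cases "ennreal u < T_infty \<omega>")
  case True
  then obtain m where m: "T m \<omega> < ennreal u" "ennreal u \<le> T (Suc m) \<omega>"
    using ex_T_interval[OF assms(2)] by blast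
  have "ennreal u \<noteq> T (Suc m) \<omega>"
    using assms(2,3) by (metis enn2real_ennreal less_imp_le rangeI)
  with m show ?thesis
    using \<xi>_minus_eq[OF assms(1) m] \<xi>_eq[of m \<omega> u] by (auto simp: less_le)
qed (use assms in \<open>auto simp: \<xi>_def \<xi>_minus_def\<close>)

section \<open>Transition rates\<close>

text \<open>Bridge between the unconditional real sums of the rate hypotheses and the nonnegative
  integrals over counting measure in which the compensator formula is stated; for reals,
  unconditional summability is absolute summability.\<close>

lemma nn_integral_count_space_has_sum:
  fixes f :: "'b \<Rightarrow> real"
  assumes "(f has_sum S) A" "\<And>x. x \<in> A \<Longrightarrow> 0 \<le> f x"
  shows "(\<integral>\<^sup>+x. ennreal (f x) \<partial>count_space A) = ennreal S"
proof -
  have "Infinite_Set_Sum.abs_summable_on f A"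
    using has_sum_imp_summable[OF assms(1)]
    by (rule abs_summable_equivalent[THEN iffD1, OF summable_on_iff_abs_summable_on_real[THEN iffD1]])
  then show ?thesis
    using assms by (simp add: nn_integral_conv_infsetsum infsetsum_infsum infsumI)
qed

text \<open>The diagonal entry is the only one that can be negative. What remains passes to
  \<open>ennreal\<close> without loss and is exactly the kernel in the compensator.\<close>

definition off_rate :: "('s \<Rightarrow> 'a set) \<Rightarrow> ('s \<Rightarrow> 's \<Rightarrow> 'a \<Rightarrow> real)
    \<Rightarrow> 's \<Rightarrow> 's option \<Rightarrow> 'a option \<Rightarrow> real" where
  "off_rate Adm q j k a = (if k = Some j then 0 else rate Adm q j k a)"

definition exit_rate :: "('s \<Rightarrow> 'a set) \<Rightarrow> ('s \<Rightarrow> 's \<Rightarrow> 'a \<Rightarrow> real)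
    \<Rightarrow> 's option \<Rightarrow> 'a option \<Rightarrow> real" where
  "exit_rate Adm q k a = (case k of Some i \<Rightarrow> - rate Adm q i k a | None \<Rightarrow> 0)"

context ctmdp_model
begin

lemma off_rate_nonneg: "0 \<le> off_rate Adm q j k a"
  using rate_nonneg by (auto simp: off_rate_def rate_def split: option.splits)

lemma rate_has_sum: "((\<lambda>j. rate Adm q j k a) has_sum 0) UNIV"
proof (cases "\<exists>i c. k = Some i \<and> a = Some c \<and> c \<in> Adm i")
  case True
  then show ?thesis
    using rate_conservative by (auto simp: rate_def)
next
  case False
  then show ?thesis
    by (intro has_sum_0) (auto simp: rate_def split: option.splits)
qed

text \<open>The two families differ only at j = i, where the diagonal contributes minus f(i) times
  the exit rate. The value S stays open because the correction is used twice: for f = 1, where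
  conservativeness gives S = 0, and for f = w, where the drift condition bounds S.\<close>

lemma has_sum_off_rate:
  assumes "((\<lambda>j. f j * rate Adm q j k a) has_sum S) UNIV"
  shows "((\<lambda>j. f j * off_rate Adm q j k a) has_sum
    (S + (case k of Some i \<Rightarrow> f i | None \<Rightarrow> 0) * exit_rate Adm q k a)) UNIV"
proof (cases k)
  case None
  then show ?thesis
    using assms by (simp add: off_rate_def exit_rate_def rate_def)
next
  case (Some i)
  have "((\<lambda>j. if j = i then - f i * rate Adm q i k a else 0) has_sum
      (- f i * rate Adm q i k a)) UNIV"
    using has_sum_finite[of "{i}" "\<lambda>j. if j = i then - f i * rate Adm q i k a else 0"]
    by (subst has_sum_cong_neutral[where T="{i}"]) auto
  from has_sum_add[OF assms this] show ?thesis
    by (rule back_subst[where P="\<lambda>x. x"], intro arg_cong2[where f="\<lambda>g y. (g has_sum y) UNIV"] ext)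
      (auto simp: Some exit_rate_def off_rate_def)
qed

lemma off_rate_has_sum: "((\<lambda>j. off_rate Adm q j k a) has_sum exit_rate Adm q k a) UNIV"
proof -
  have "(case k of Some i \<Rightarrow> 1 | None \<Rightarrow> 0) * exit_rate Adm q k a = exit_rate Adm q k a"
    by (simp add: exit_rate_def split: option.splits)
  moreover have "((\<lambda>j. 1 * rate Adm q j k a) has_sum 0) UNIV"
    using rate_has_sum by simp
  note has_sum_off_rate[OF this]
  ultimately show ?thesis
    by (simp only: mult_1 add_0)
qed

lemma nn_integral_off_rate:
  "(\<integral>\<^sup>+j. ennreal (off_rate Adm q j k a) \<partial>count_space UNIV) = ennreal (exit_rate Adm q k a)"
  by (rule nn_integral_count_space_has_sum[OF off_rate_has_sum off_rate_nonneg])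

lemma exit_rate_nonneg: "0 \<le> exit_rate Adm q k a"
  using off_rate_has_sum off_rate_nonneg by (rule has_sum_nonneg)

text \<open>At inadmissible actions the rates are 0 by convention, and if \<open>Adm i\<close> is
  empty the supremum \<open>qstar\<close> carries no information; this is why C has to be
  nonnegative in its own right.\<close>

lemma exit_rate_le:
  assumes "qstar Adm q i \<le> C" "0 \<le> C"
  shows "exit_rate Adm q (Some i) a \<le> C"
proof (cases "\<exists>c. a = Some c \<and> c \<in> Adm i")
  case True
  then obtain c where c: "a = Some c" "c \<in> Adm i" by blast
  have "\<bar>q i i c\<bar> \<le> qstar Adm q i"
    unfolding qstar_def using c(2) rate_stable by (rule cSUP_upper)
  then show ?thesis
    using c assms(1) by (simp add: exit_rate_def rate_def)
next
  case False
  then have "exit_rate Adm q (Some i) a = 0"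
    by (auto simp: exit_rate_def rate_def split: option.splits)
  then show ?thesis
    using assms(2) by simp
qed

text \<open>The diagonal term of the drift condition moves to the right, where it becomes w(k) times
  the exit rate. In this form every term is nonnegative.\<close>

lemma off_rate_drift:
  assumes "\<And>k. 0 \<le> w k"
    and "\<And>k a. a \<in> Adm k \<Longrightarrow> (\<lambda>j. w j * q j k a) summable_on UNIV \<and> (\<Sum>\<^sub>\<infinity>j. w j * q j k a) \<le> c * w k"
    and "0 \<le> c"
  shows "(\<integral>\<^sup>+j. ennreal (w j) * ennreal (off_rate Adm q j (Some k) a) \<partial>count_space UNIV)
    \<le> ennreal c * ennreal (w k) + ennreal (w k) * ennreal (exit_rate Adm q (Some k) a)"
proof -
  obtain S where S: "((\<lambda>j. w j * rate Adm q j (Some k) a) has_sum S) UNIV" "S \<le> c * w k"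
  proof (cases "\<exists>d. a = Some d \<and> d \<in> Adm k")
    case True
    then obtain d where d: "a = Some d" "d \<in> Adm k" by blast
    show ?thesis
      using assms(2)[OF d(2)] d by (intro that[OF has_sum_infsum]) (auto simp: rate_def)
  next
    case False
    then have "((\<lambda>j. w j * rate Adm q j (Some k) a) has_sum 0) UNIV"
      by (intro has_sum_0) (auto simp: rate_def split: option.splits)
    then show ?thesis
      using assms by (intro that[of 0]) auto
  qed
  have "(\<integral>\<^sup>+j. ennreal (w j * off_rate Adm q j (Some k) a) \<partial>count_space UNIV)
      = ennreal (S + w k * exit_rate Adm q (Some k) a)"
    using has_sum_off_rate[OF S(1)] assms(1) off_rate_nonneg
    by (intro nn_integral_count_space_has_sum) auto
  also have "\<dots> \<le> ennreal (c * w k + w k * exit_rate Adm q (Some k) a)"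
    using S(2) by (intro ennreal_leI) auto
  finally show ?thesis
    using assms exit_rate_nonneg[of "Some k" a] off_rate_nonneg
    by (simp add: ennreal_plus ennreal_mult)
qed

text \<open>From k outside B every rate into B is off-diagonal, hence nonnegative; from k in B
  conservativeness makes q(B|k,a) minus the rate into the complement of B. So the sign of q(B|k,a)
  is fixed by k alone, whatever the action.\<close>

lemma ennreal_rate_set:
  "k \<notin> Some ` B \<Longrightarrow> ennreal (rate_set Adm q B k a)
     = (\<integral>\<^sup>+j. ennreal (off_rate Adm q j k a) * indicator B j \<partial>count_space UNIV)"
  "k \<in> Some ` B \<Longrightarrow> ennreal (- rate_set Adm q B k a)
     = (\<integral>\<^sup>+j. ennreal (off_rate Adm q j k a) * indicator (- B) j \<partial>count_space UNIV)"
  "k \<notin> Some ` B \<Longrightarrow> 0 \<le> rate_set Adm q B k a"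
  "k \<in> Some ` B \<Longrightarrow> rate_set Adm q B k a \<le> 0"
proof -
  have summable: "(\<lambda>j. rate Adm q j k a) summable_on A" for A
    by (rule summable_on_subset_banach[OF has_sum_imp_summable[OF rate_has_sum]]) simp
  have split: "rate_set Adm q B k a + (\<Sum>\<^sub>\<infinity>j\<in>-B. rate Adm q j k a) = 0"
    unfolding rate_set_def using infsumI[OF rate_has_sum, of k a]
    by (subst infsum_Un_disjoint[symmetric]) (auto simp: summable)
  have *: "((\<lambda>j. off_rate Adm q j k a) has_sum (\<Sum>\<^sub>\<infinity>j\<in>A. rate Adm q j k a)) A" if "k \<notin> Some ` A" for A
    using has_sum_infsum[OF summable[of A]] that
    by (subst has_sum_cong[where g="\<lambda>j. rate Adm q j k a"]) (auto simp: off_rate_def)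
  have ind: "(\<integral>\<^sup>+j. ennreal (off_rate Adm q j k a) * indicator A j \<partial>count_space UNIV)
      = ennreal (\<Sum>\<^sub>\<infinity>j\<in>A. rate Adm q j k a)" if "k \<notin> Some ` A" for A
    using nn_integral_count_space_has_sum[OF *[OF that] off_rate_nonneg]
      nn_integral_restrict_space[of A "count_space UNIV" "\<lambda>j. ennreal (off_rate Adm q j k a)"]
    by (simp add: restrict_count_space)
  have nonneg: "0 \<le> (\<Sum>\<^sub>\<infinity>j\<in>A. rate Adm q j k a)" if "k \<notin> Some ` A" for A
    using *[OF that] off_rate_nonneg by (rule has_sum_nonneg)
  show "k \<notin> Some ` B \<Longrightarrow> ennreal (rate_set Adm q B k a)
     = (\<integral>\<^sup>+j. ennreal (off_rate Adm q j k a) * indicator B j \<partial>count_space UNIV)"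
    by (simp add: ind rate_set_def)
  show "k \<notin> Some ` B \<Longrightarrow> 0 \<le> rate_set Adm q B k a"
    unfolding rate_set_def by (rule nonneg)
  assume "k \<in> Some ` B"
  then have k: "k \<notin> Some ` (- B)" by auto
  show "ennreal (- rate_set Adm q B k a)
     = (\<integral>\<^sup>+j. ennreal (off_rate Adm q j k a) * indicator (- B) j \<partial>count_space UNIV)"
    using split by (subst ind[OF k]) (simp add: add_eq_0_iff)
  show "rate_set Adm q B k a \<le> 0"
    using split nonneg[OF k] by simp
qed

end

section \<open>Borel sets of the extended action space and measurability of the rates\<close>

lemma Some_image_in_borel_infty:
  assumes "D \<in> sets borel"
  shows "Some ` D \<in> sets borel_infty"
proof -
  have eq: "sets borel_infty = sigma_sets UNIV {U. open {a. Some a \<in> U}}"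
    by (simp add: borel_infty_def)
  have range: "range Some \<in> sets (borel_infty :: 'b::topological_space option measure)"
    unfolding eq by (rule sigma_sets.Basic) simp
  from assms show ?thesis
    unfolding sets_borel
  proof (induction D rule: sigma_sets.induct)
    case (Basic D)
    then show ?case
      unfolding eq by (intro sigma_sets.Basic) (auto simp: image_iff)
  next
    case (Compl D)
    \<comment> \<open>Complements are taken inside \<open>range Some\<close>, which is itself open
      in the extended space.\<close>
    have "Some ` (UNIV - D) = range Some - Some ` D"
      by auto
    then show ?case
      using range Compl by auto
  next
    case (Union D)
    then show ?case
      by (auto simp: image_UN)
  qed auto
qed

lemma space_borel_infty [simp]: "space borel_infty = UNIV"
  by (simp add: borel_infty_def)

text \<open>The adjoined point is isolated, so adding or removing it does not affect measurability,
  and only the trace on A has to be checked.\<close>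

lemma sets_borel_inftyI:
  fixes U :: "'a::topological_space option set"
  assumes "{a. Some a \<in> U} \<in> sets borel"
  shows "U \<in> sets borel_infty"
proof -
  have "{None} \<in> sets (borel_infty :: 'a option measure)"
    unfolding borel_infty_def by (subst sets_measure_of) (auto intro: sigma_sets.Basic)
  then have "Some ` {a. Some a \<in> U} \<union> (if None \<in> U then {None} else {}) \<in> sets borel_infty"
    by (intro sets.Un Some_image_in_borel_infty[OF assms]) auto
  also have "Some ` {a. Some a \<in> U} \<union> (if None \<in> U then {None} else {}) = U"
  proof (rule set_eqI)
    show "x \<in> Some ` {a. Some a \<in> U} \<union> (if None \<in> U then {None} else {}) \<longleftrightarrow> x \<in> U" for x
      by (cases x) auto
  qed
  finally show ?thesis .
qed

lemma measurable_borel_inftyI: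
  assumes "(\<lambda>a. f (Some a)) \<in> borel \<rightarrow>\<^sub>M M" "f None \<in> space M"
  shows "f \<in> borel_infty \<rightarrow>\<^sub>M M"
proof (rule measurableI)
  fix A assume "A \<in> sets M"
  then show "f -` A \<inter> space borel_infty \<in> sets borel_infty"
    using measurable_sets[OF assms(1)] by (intro sets_borel_inftyI) (simp add: vimage_def)
next
  show "f x \<in> space M" for x
    using assms measurable_space[OF assms(1)] by (cases x) auto
qed

lemma (in ctmdp_model) rate_borel_measurable: "rate Adm q j k \<in> borel_measurable borel_infty"
proof (rule measurable_borel_inftyI)
  show "(\<lambda>a. rate Adm q j k (Some a)) \<in> borel_measurable borel"
  proof (cases k)
    case (Some i)
    \<comment> \<open>Measurability on the restricted space amounts to measurability of the
      extension by 0, which is precisely the convention built into \<open>rate\<close>.\<close>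
    have "(\<lambda>c. indicator (Adm i) c *\<^sub>R q j i c) \<in> borel_measurable borel"
      using rate_measurable[of j i] Adm_measurable[of i] by (simp add: borel_measurable_restrict_space_iff)
    then show ?thesis
      by (rule measurable_cong[THEN iffD1, rotated]) (simp add: Some rate_def)
  qed (simp add: rate_def)
qed simp

lemma (in ctmdp_model) exit_rate_borel_measurable: "exit_rate Adm q k \<in> borel_measurable borel_infty"
  using rate_borel_measurable by (cases k) (auto simp: exit_rate_def[abs_def])

lemma (in ctmdp_model) off_rate_borel_measurable: "off_rate Adm q j k \<in> borel_measurable borel_infty"
  using rate_borel_measurable by (cases "k = Some j") (auto simp: off_rate_def[abs_def])

section \<open>Filtrations and predictability\<close>

lemma space_path_space [simp]: "space path_space = Omega"
  by (simp add: path_space_def space_restrict_space space_pair_measure space_PiM)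

lemma measurable_X [measurable]: "X m \<in> path_space \<rightarrow>\<^sub>M count_space UNIV"
  unfolding path_space_def X_def[abs_def] by (intro measurable_restrict_space1) measurable

lemma measurable_T [measurable]: "T m \<in> borel_measurable path_space"
  unfolding path_space_def T_def[abs_def] \<Theta>_def[abs_def] by (intro measurable_restrict_space1) measurable

lemma space_\<F> [simp]: "space (\<F> t) = Omega"
  by (simp add: \<F>_def space_measure_of_conv)

lemma sets_\<F>:
  "sets (\<F> t) = sigma_sets Omega
     {{\<omega> \<in> Omega. T m \<omega> \<le> ennreal s \<and> X m \<omega> = Some j} | m s j. 0 \<le> s \<and> s \<le> t}"
  unfolding \<F>_def by (rule sets_measure_of) auto

lemma sets_\<F>_subset: "sets (\<F> t :: 's::countable path measure) \<subseteq> sets path_space"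
proof -
  have "{\<omega> \<in> space path_space. T m \<omega> \<le> ennreal s \<and> X m \<omega> = Some j} \<in> sets path_space" for m s and j :: 's
    by measurable
  then have "sigma_sets (space path_space)
     {{\<omega> \<in> Omega. T m \<omega> \<le> ennreal s \<and> X m \<omega> = Some (j :: 's)} | m s j. 0 \<le> s \<and> s \<le> t} \<subseteq> sets path_space"
    by (intro sets.sigma_sets_subset) auto
  then show ?thesis
    unfolding sets_\<F> by simp
qed

lemma T_le_X_in_\<F>:
  "0 \<le> s \<Longrightarrow> {\<omega> \<in> Omega. T m \<omega> \<le> ennreal s \<and> X m \<omega> = Some j} \<in> sets (\<F> s)"
  unfolding sets_\<F> by (intro sigma_sets.Basic) auto

text \<open>The generators of \<open>\<F> s\<close> always name the state entered. A finite jump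
  time has a state, so the union over the countably many states recovers the whole event.\<close>

lemma T_le_in_\<F>:
  assumes "0 \<le> s"
  shows "{\<omega> \<in> (Omega :: 's::countable path set). T m \<omega> \<le> ennreal s} \<in> sets (\<F> s)"
proof -
  have "T m \<omega> \<le> ennreal s \<Longrightarrow> \<exists>j. X m \<omega> = Some j" if "\<omega> \<in> Omega" for \<omega> :: "'s path"
    using T_eq_infty_iff[OF that, of m] by (auto simp: top_unique)
  then have "{\<omega> \<in> (Omega :: 's path set). T m \<omega> \<le> ennreal s}
      = (\<Union>j. {\<omega> \<in> Omega. T m \<omega> \<le> ennreal s \<and> X m \<omega> = Some j})"
    by blast
  also have "\<dots> \<in> sets (\<F> s)"
    using T_le_X_in_\<F>[OF assms] by (intro sets.countable_UN image_subsetI)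
  finally show ?thesis .
qed

lemma \<xi>_in_\<F>:
  assumes "0 \<le> s"
  shows "{\<omega> \<in> (Omega :: 's::countable path set). \<xi> s \<omega> \<in> Some ` B} \<in> sets (\<F> s)"
proof -
  have "{\<omega> \<in> (Omega :: 's path set). \<xi> s \<omega> \<in> Some ` B}
      = (\<Union>m. \<Union>j\<in>B. {\<omega> \<in> Omega. T m \<omega> \<le> ennreal s \<and> X m \<omega> = Some j}
            - {\<omega> \<in> Omega. T (Suc m) \<omega> \<le> ennreal s})"
    by (auto simp: image_iff \<xi>_eq_Some_iff not_le) blast
  also have "\<dots> \<in> sets (\<F> s)"
    using T_le_X_in_\<F>[OF assms] T_le_in_\<F>[OF assms]
    by (intro sets.countable_UN sets.countable_UN'[where X=B] sets.Diff image_subsetI) auto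
  finally show ?thesis .
qed

abbreviation positive_time :: "real measure" where
  "positive_time \<equiv> restrict_space lborel {0<..}"

lemma sigma_finite_positive_time: "sigma_finite_measure positive_time"
  by (rule sigma_finite_measure_restrict_space) (auto simp: lborel.sigma_finite_measure_axioms)

section \<open>The completed stochastic basis\<close>

locale ctmdp_process = ctmdp_model Adm q
  for Adm :: "'s::countable \<Rightarrow> 'a::polish_space set" and q +
  fixes \<pi> :: "'s path \<Rightarrow> real \<Rightarrow> 'a option measure" and P :: "'s path measure" and i :: 's
  assumes policy: "\<pi> \<in> policies Adm" and law: "policy_law Adm q \<pi> (return_pmf i) P"
begin

abbreviation "M \<equiv> completion P"
abbreviation "G \<equiv> completed_filtration P"

sublocale P: prob_space P
  using law by (simp add: policy_law_def)

sublocale M: prob_space M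
  by (rule P.prob_space_completion)

lemma sets_P: "sets P = sets path_space"
  using law by (simp add: policy_law_def)

lemma space_P [simp]: "space P = Omega"
  using sets_eq_imp_space_eq[OF sets_P] by simp

lemma measurable_M: "f \<in> path_space \<rightarrow>\<^sub>M N \<Longrightarrow> f \<in> M \<rightarrow>\<^sub>M N"
  using measurable_cong_sets[OF sets_P refl] measurable_completion by blast

lemma X_measurable_M [measurable]: "X m \<in> M \<rightarrow>\<^sub>M count_space UNIV"
  by (rule measurable_M[OF measurable_X])

lemma T_measurable_M [measurable]: "T m \<in> borel_measurable M"
  by (rule measurable_M[OF measurable_T])

lemma generator_subset_Pow: "sets (\<F> t) \<union> null_sets M \<subseteq> Pow Omega"
  using sets.sets_into_space[of _ "\<F> t"] sets.sets_into_space[of _ M] by auto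

lemma space_G [simp]: "space (G t) = Omega"
  by (simp add: completed_filtration_def space_measure_of_conv)

lemma sets_G: "sets (G t) = sigma_sets Omega (sets (\<F> t) \<union> null_sets M)"
  unfolding completed_filtration_def using generator_subset_Pow by (rule sets_measure_of)

lemma sets_\<F>_subset_G: "sets (\<F> t) \<subseteq> sets (G t)"
  unfolding sets_G by (auto intro: sigma_sets.Basic)

lemma sets_G_subset: "sets (G t) \<subseteq> sets M"
proof -
  have "sets (\<F> t) \<union> null_sets M \<subseteq> sets M"
    using sets_\<F>_subset sets_P by auto
  then have "sigma_sets (space M) (sets (\<F> t) \<union> null_sets M) \<subseteq> sets M"
    by (rule sets.sigma_sets_subset)
  then show ?thesis
    unfolding sets_G by simp
qed

lemma subalgebra_G: "subalgebra M (G t)"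
  using sets_G_subset by (simp add: subalgebra_def)

lemma left_limit_sets_subset: "left_limit_sets G s \<subseteq> sets M"
proof -
  have "sigma_sets (space M) (\<Union>t\<in>{0..<s}. sets (G t)) \<subseteq> sets M"
    using sets_G_subset by (intro sets.sigma_sets_subset) blast
  then show ?thesis
    by (simp add: left_limit_sets_def)
qed

lemma space_predictable [simp]: "space (predictable H) = Omega \<times> {0..}"
  by (simp add: predictable_def space_measure_of_conv)

lemma sets_predictable:
  "sets (predictable G) = sigma_sets (Omega \<times> {0..})
     ({B \<times> {0} | B. B \<in> sets (G 0)} \<union> {B \<times> {s<..} | B s. 0 < s \<and> B \<in> left_limit_sets G s})"
  unfolding predictable_def
proof (intro sets_measure_of subsetI PowI, elim UnE CollectE exE conjE)
  fix D and x :: "'s path \<times> real" and B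
  assume "D = B \<times> {0}" "B \<in> sets (G 0)" "x \<in> D"
  then show "x \<in> Omega \<times> {0..}"
    using sets.sets_into_space[of B "G 0"] by auto
next
  fix D and x :: "'s path \<times> real" and B s
  assume "D = B \<times> {s<..}" "0 < s" "B \<in> left_limit_sets G s" "x \<in> D"
  then show "x \<in> Omega \<times> {0..}"
    using left_limit_sets_subset sets.sets_into_space[of B M] by auto
qed

text \<open>A generator over (s,\<infinity>) requires s > 0 and an event of the strict past of s. An
  event of the past of s belongs to the strict past of s + 1/n, and the rectangles starting there
  increase to the claimed one; this also covers s = 0.\<close>

lemma predictable_rectangle:
  assumes "0 \<le> s" "\<Gamma> \<in> sets (G s)"
  shows "\<Gamma> \<times> {s<..} \<in> sets (predictable G)"
proof -
  have "\<Gamma> \<times> {s + inverse (real (Suc n))<..} \<in> sets (predictable G)" for n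
  proof -
    have "\<Gamma> \<in> left_limit_sets G (s + inverse (real (Suc n)))"
      unfolding left_limit_sets_def using assms by (intro sigma_sets.Basic) auto
    then show ?thesis
      unfolding sets_predictable using assms(1)
      by (intro sigma_sets.Basic UnI2 CollectI exI conjI refl) (auto intro: add_nonneg_pos)
  qed
  then have "(\<Union>n. \<Gamma> \<times> {s + inverse (real (Suc n))<..}) \<in> sets (predictable G)"
    by blast
  moreover have "(\<Union>n. \<Gamma> \<times> {s + inverse (real (Suc n))<..}) = \<Gamma> \<times> {s<..}"
  proof -
    have "\<exists>n. s + inverse (real (Suc n)) < u" if "s < u" for u
      using reals_Archimedean[of "u - s"] that by (auto simp: algebra_simps)
    moreover have "s < u" if "s + inverse (real (Suc n)) < u" for u n
      using that by (smt (verit) inverse_positive_iff_positive of_nat_0_less_iff zero_less_Suc)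
    ultimately show ?thesis
      by fastforce
  qed
  ultimately show ?thesis by simp
qed

text \<open>Predictable sets are product measurable, so a predictable target asks for less than a
  product target. This makes path sections and Fubini arguments available for predictable
  integrands.\<close>

lemma measurable_to_predictable:
  assumes f: "f \<in> N \<rightarrow>\<^sub>M M \<Otimes>\<^sub>M restrict_space borel {0..}"
  shows "f \<in> N \<rightarrow>\<^sub>M predictable G"
proof -
  have sub: "B \<times> D \<in> sets (M \<Otimes>\<^sub>M restrict_space borel {0..})"
    if "B \<in> sets M" "D \<subseteq> {0..}" "D \<in> sets borel" for B and D :: "real set"
    using that by (intro pair_measureI) (auto simp: sets_restrict_space_iff)
  have "sets (predictable G) \<subseteq> sets (M \<Otimes>\<^sub>M restrict_space borel {0..})"
    unfolding sets_predictable
  proof (rule sets.sigma_sets_subset[of _ "M \<Otimes>\<^sub>M restrict_space borel {0..}", simplified space_pair_measure space_completion space_P space_restrict_space space_borel Int_UNIV_right])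
    show "{B \<times> {0} | B. B \<in> sets (G 0)} \<union> {B \<times> {s<..} | B s. 0 < s \<and> B \<in> left_limit_sets G s}
        \<subseteq> sets (M \<Otimes>\<^sub>M restrict_space borel {0..})"
      using sets_G_subset left_limit_sets_subset by (auto intro!: sub)
  qed
  then have "(\<lambda>x. x) \<in> M \<Otimes>\<^sub>M restrict_space borel {0..} \<rightarrow>\<^sub>M predictable G"
    by (auto intro!: measurableI simp: space_pair_measure space_restrict_space)
  from measurable_compose[OF f this] show ?thesis .
qed

lemma predictable_to_product:
  assumes "f \<in> predictable G \<rightarrow>\<^sub>M N"
  shows "f \<in> M \<Otimes>\<^sub>M positive_time \<rightarrow>\<^sub>M N"
proof -
  have "(\<lambda>x. x) \<in> positive_time \<rightarrow>\<^sub>M restrict_space borel {0..}"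
    by (rule measurable_restrict_space2) (auto simp: space_restrict_space intro!: measurable_restrict_space1)
  then have "(\<lambda>x. (fst x, snd x)) \<in> M \<Otimes>\<^sub>M positive_time \<rightarrow>\<^sub>M M \<Otimes>\<^sub>M restrict_space borel {0..}"
    by (intro measurable_Pair measurable_fst measurable_compose[OF measurable_snd])
  from measurable_compose[OF measurable_to_predictable[OF this] assms] show ?thesis
    by simp
qed

text \<open>Policies are predictable for the raw filtration, whereas the compensator formula tests
  with the completed one; completion only enlarges the predictable sigma-algebra.\<close>

lemma predictable_\<F>_to_G:
  assumes "f \<in> predictable \<F> \<rightarrow>\<^sub>M N"
  shows "f \<in> predictable G \<rightarrow>\<^sub>M N"
proof -
  have "left_limit_sets \<F> s \<subseteq> left_limit_sets G s" for s
    unfolding left_limit_sets_def using sets_\<F>_subset_G by (intro sigma_sets_mono') blast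
  then have gen: "{B \<times> {0} | B. B \<in> sets (\<F> 0)} \<union> {B \<times> {s<..} | B s. 0 < s \<and> B \<in> left_limit_sets \<F> s}
      \<subseteq> sets (predictable G)" (is "?E \<subseteq> _")
    unfolding sets_predictable using sets_\<F>_subset_G[of 0] by (intro subsetI sigma_sets.Basic) blast
  moreover have "?E \<subseteq> Pow (Omega \<times> {0..})"
    using gen sets.space_closed[of "predictable G"] unfolding space_predictable by (rule order_trans)
  ultimately have "(\<lambda>x. x) \<in> predictable G \<rightarrow>\<^sub>M predictable \<F>"
    unfolding predictable_def[of \<F>]
  proof (intro measurable_measure_of)
    fix A assume "A \<in> ?E"
    then have "A \<in> sets (predictable G)"
      using gen by blast
    then show "(\<lambda>x. x) -` A \<inter> space (predictable G) \<in> sets (predictable G)"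
      using sets.Int_space_eq2[of A "predictable G"] by (simp del: space_predictable)
  qed auto
  from measurable_compose[OF this assms] show ?thesis
    by simp
qed

end

lemma measurable_pair_count_space:
  fixes f :: "'b \<times> 'c::countable \<Rightarrow> 'd"
  assumes "\<And>k. (\<lambda>x. f (x, k)) \<in> N \<rightarrow>\<^sub>M K"
  shows "f \<in> N \<Otimes>\<^sub>M count_space UNIV \<rightarrow>\<^sub>M K"
proof -
  have "(\<lambda>x. f (fst x, snd x)) \<in> N \<Otimes>\<^sub>M count_space UNIV \<rightarrow>\<^sub>M K"
    by (rule measurable_compose_countable[of "\<lambda>k x. f (fst x, k)", OF measurable_compose[OF measurable_fst assms] measurable_snd])
  then show ?thesis
    by simp
qed

lemma measurable_nn_integral_count_space:
  fixes f :: "'c::countable \<Rightarrow> 'b \<Rightarrow> ennreal"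
  assumes "\<And>k. f k \<in> borel_measurable N"
  shows "(\<lambda>x. \<integral>\<^sup>+k. f k x \<partial>count_space UNIV) \<in> borel_measurable N"
proof (rule sigma_finite_measure.borel_measurable_nn_integral[OF sigma_finite_measure_count_space])
  show "(\<lambda>(x, k). f k x) \<in> borel_measurable (N \<Otimes>\<^sub>M count_space UNIV)"
    by (rule measurable_pair_count_space) (simp add: assms)
qed

section \<open>Sojourn intervals and left limits as predictable objects\<close>

context ctmdp_process
begin

text \<open>Open on the left and closed on the right: membership at u is then decided by the strict
  past of u, and the interval contains the jump that ends it but not the one that starts it.\<close>

definition sojourn :: "nat \<Rightarrow> ('s path \<times> real) set" where
  "sojourn m = {(\<omega>, u). \<omega> \<in> Omega \<and> T m \<omega> < ennreal u \<and> ennreal u \<le> T (Suc m) \<omega>}"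

text \<open>By a rational time r between \<open>T m \<omega>\<close> and u the jump has already been
  observed, which turns the set into a countable union of predictable rectangles.\<close>

lemma sets_predictable_T_less:
  "{(\<omega>, u). \<omega> \<in> Omega \<and> T m \<omega> < ennreal u \<and> X m \<omega> = Some j} \<in> sets (predictable G)"
proof -
  have "{(\<omega>, u). \<omega> \<in> Omega \<and> T m \<omega> < ennreal u \<and> X m \<omega> = Some j}
     = (\<Union>r\<in>{r \<in> \<rat>. 0 \<le> r}. {\<omega> \<in> Omega. T m \<omega> \<le> ennreal r \<and> X m \<omega> = Some j} \<times> {r<..})"
    (is "?L = ?R")
  proof (intro equalityI subsetI)
    fix x assume "x \<in> ?L"
    then obtain \<omega> u where x: "x = (\<omega>, u)" "\<omega> \<in> Omega" "T m \<omega> < ennreal u" "X m \<omega> = Some j"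
      by auto
    define v where "v = enn2real (T m \<omega>)"
    have v: "T m \<omega> = ennreal v" "0 \<le> v"
      using x(3) by (auto simp: v_def less_top[symmetric] ennreal_enn2real_if)
    then have "v < u"
      using x(3) by (simp add: ennreal_less_iff)
    then obtain r where "r \<in> \<rat>" "v < r" "r < u"
      using Rats_dense_in_real by blast
    then show "x \<in> ?R"
      using x v by (auto intro!: bexI[of _ r])
  next
    fix x assume "x \<in> ?R"
    then show "x \<in> ?L"
      by (auto simp: ennreal_less_iff intro: le_less_trans)
  qed
  also have "\<dots> \<in> sets (predictable G)"
  proof (rule sets.countable_UN'')
    show "countable {r \<in> \<rat>. 0 \<le> (r :: real)}"
      by (rule countable_subset[OF _ countable_rat]) auto
    fix r :: real assume "r \<in> {r \<in> \<rat>. 0 \<le> r}"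
    then show "{\<omega> \<in> Omega. T m \<omega> \<le> ennreal r \<and> X m \<omega> = Some j} \<times> {r<..} \<in> sets (predictable G)"
      using subsetD[OF sets_\<F>_subset_G T_le_X_in_\<F>[of r m j]] by (intro predictable_rectangle) auto
  qed
  finally show ?thesis .
qed

lemma sets_predictable_sojourn:
  "{(\<omega>, u) \<in> sojourn m. X m \<omega> = Some k} \<in> sets (predictable G)"
proof -
  have "{(\<omega>, u) \<in> sojourn m. X m \<omega> = Some k}
    = {(\<omega>, u). \<omega> \<in> Omega \<and> T m \<omega> < ennreal u \<and> X m \<omega> = Some k}
      - (\<Union>j. {(\<omega>, u). \<omega> \<in> Omega \<and> T (Suc m) \<omega> < ennreal u \<and> X (Suc m) \<omega> = Some j})"
  proof -
    \<comment> \<open>The times after the right end are removed through sets that record a state;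
      this catches every path with \<open>T (Suc m) \<omega> < ennreal u\<close>, since such a jump
      time is finite.\<close>
    have "ennreal u \<le> T (Suc m) \<omega> \<longleftrightarrow> \<not> (T (Suc m) \<omega> < ennreal u \<and> (\<exists>j. X (Suc m) \<omega> = Some j))"
      if "\<omega> \<in> Omega" for \<omega> :: "'s path" and u
      using T_eq_infty_iff[OF that, of "Suc m"] by (cases "X (Suc m) \<omega>") (auto simp: not_less)
    then show ?thesis
      by (auto simp: sojourn_def)
  qed
  also have "\<dots> \<in> sets (predictable G)"
    using sets_predictable_T_less by (intro sets.Diff sets.countable_UN) auto
  finally show ?thesis .
qed

lemma sojourn_state:
  assumes "(\<omega>, u) \<in> sojourn m"
  obtains k where "X m \<omega> = Some k"
  using assms T_eq_infty_iff[of \<omega> m] by (auto simp: sojourn_def)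

lemma sojourn_in_predictable: "sojourn m \<in> sets (predictable G)"
proof -
  have "sojourn m = (\<Union>k. {(\<omega>, u) \<in> sojourn m. X m \<omega> = Some k})"
    by (auto elim: sojourn_state)
  also have "\<dots> \<in> sets (predictable G)"
    using sets_predictable_sojourn by (intro sets.countable_UN) auto
  finally show ?thesis .
qed

lemma \<xi>_minus_predictable:
  "{(\<omega>, u). \<omega> \<in> Omega \<and> 0 < u \<and> \<xi>_minus u \<omega> \<in> Some ` B} \<in> sets (predictable G)"
proof -
  have "{(\<omega>, u). \<omega> \<in> Omega \<and> 0 < u \<and> \<xi>_minus u \<omega> \<in> Some ` B}
      = (\<Union>m. \<Union>k\<in>B. {(\<omega>, u) \<in> sojourn m. X m \<omega> = Some k})" (is "?L = ?R")
  proof (intro equalityI subsetI)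
    fix x assume "x \<in> ?L"
    then obtain \<omega> u k where "x = (\<omega>, u)" "\<omega> \<in> Omega" "0 < u" "k \<in> B" "\<xi>_minus u \<omega> = Some k"
      by auto
    then show "x \<in> ?R"
      using \<xi>_minus_eq_Some_iff[of \<omega> u k] by (auto simp: sojourn_def)
  next
    fix x assume "x \<in> ?R"
    then obtain \<omega> u m k where x: "x = (\<omega>, u)" "(\<omega>, u) \<in> sojourn m" "X m \<omega> = Some k" "k \<in> B"
      by auto
    then have "0 < u"
      using le_less_trans[OF zero_le, of "T m \<omega>" "ennreal u"] by (simp add: sojourn_def)
    with x show "x \<in> ?L"
      using \<xi>_minus_eq[of \<omega> m u] by (auto simp: sojourn_def)
  qed
  also have "\<dots> \<in> sets (predictable G)"
    using sets_predictable_sojourn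
    by (intro sets.countable_UN sets.countable_UN'[where X=B] image_subsetI) auto
  finally show ?thesis .
qed

lemma time_measurable_predictable [measurable]: "snd \<in> borel_measurable (predictable G)"
proof (rule borel_measurable_iff_greater[THEN iffD2], rule allI)
  fix r :: real
  have "{x \<in> space (predictable G). r < snd x} = (if r < 0 then space (predictable G) else Omega \<times> {r<..})"
    by auto
  also have "\<dots> \<in> sets (predictable G)"
    using predictable_rectangle[of r Omega] sets.top[of "G r"] sets.top[of "predictable G"] by auto
  finally show "{x \<in> space (predictable G). r < snd x} \<in> sets (predictable G)" .
qed

text \<open>Before \<open>T m\<close> the value of \<open>X m\<close> is not known to the past, so
  \<open>f (X m (fst x))\<close> alone need not be predictable; cut down to the sojourn it is.
  Splitting over the countably many values reduces the claim to predictable sets.\<close>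

lemma X_measurable_sojourn:
  "(\<lambda>x. indicator (sojourn m) x * f (X m (fst x)) :: ennreal) \<in> borel_measurable (predictable G)"
proof -
  have "(\<lambda>x. indicator (sojourn m) x * f (X m (fst x)) :: ennreal)
      = (\<lambda>x. \<integral>\<^sup>+k. indicator {(\<omega>, u) \<in> sojourn m. X m \<omega> = Some k} x * f (Some k) \<partial>count_space UNIV)"
  proof
    fix x
    show "indicator (sojourn m) x * f (X m (fst x))
      = (\<integral>\<^sup>+k. indicator {(\<omega>, u) \<in> sojourn m. X m \<omega> = Some k} x * f (Some k) \<partial>count_space UNIV)"
    proof (cases "x \<in> sojourn m")
      case True
      then obtain k where k: "X m (fst x) = Some k"
        using sojourn_state[of "fst x" "snd x" m] by auto
      have "(\<integral>\<^sup>+k. indicator {(\<omega>, u) \<in> sojourn m. X m \<omega> = Some k} x * f (Some k) \<partial>count_space UNIV)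
          = (\<integral>\<^sup>+l. f (Some l) * indicator {k} l \<partial>count_space UNIV)"
        using True k by (intro nn_integral_cong) (auto simp: indicator_def split_beta)
      then show ?thesis
        using True k by (simp add: nn_integral_indicator_singleton)
    qed (cases x, auto simp: indicator_def)
  qed
  moreover have "\<dots> \<in> borel_measurable (predictable G)"
    using sets_predictable_sojourn by (intro measurable_nn_integral_count_space) auto
  ultimately show ?thesis
    by simp
qed

section \<open>The jump intensity under the policy\<close>

definition jump_rate :: "'s path \<Rightarrow> real \<Rightarrow> 's \<Rightarrow> ennreal" where
  "jump_rate \<omega> u j = (\<integral>\<^sup>+a. ennreal (off_rate Adm q j (\<xi>_minus u \<omega>) a) \<partial>\<pi> \<omega> u)"

lemma policy_compensator_eq:
  "policy_compensator Adm q \<pi> \<omega> = density mark_space (\<lambda>(u, j). jump_rate \<omega> u j)"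
proof -
  have "ennreal (rate Adm q j k a) * indicator {l. l \<noteq> k} (Some j) = ennreal (off_rate Adm q j k a)" for j k a
    by (auto simp: off_rate_def indicator_def)
  then show ?thesis
    by (simp add: policy_compensator_def jump_rate_def)
qed

lemma policy_measurable:
  "(\<lambda>(\<omega>, u). \<pi> \<omega> u) \<in> M \<Otimes>\<^sub>M positive_time \<rightarrow>\<^sub>M prob_algebra borel_infty"
  using policy unfolding policies_def by (intro predictable_to_product predictable_\<F>_to_G) simp

lemma
  assumes "\<omega> \<in> Omega" "0 < u"
  shows prob_space_policy: "prob_space (\<pi> \<omega> u)"
    and sets_policy: "sets (\<pi> \<omega> u) = sets borel_infty"
  using measurable_space[OF policy_measurable, of "(\<omega>, u)"] assms
  by (auto simp: space_pair_measure space_restrict_space space_prob_algebra)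

lemma \<xi>_minus_measurable:
  "(\<lambda>(\<omega>, u). \<xi>_minus u \<omega>) \<in> M \<Otimes>\<^sub>M positive_time \<rightarrow>\<^sub>M count_space UNIV"
proof (rule measurableI)
  fix A :: "'s option set"
  let ?S = "\<lambda>B. {(\<omega>, u). \<omega> \<in> Omega \<and> 0 < u \<and> \<xi>_minus u \<omega> \<in> Some ` B}"
  have *: "?S B \<in> sets (M \<Otimes>\<^sub>M positive_time)" for B
  proof -
    \<comment> \<open>The transfer from predictable to product measurability speaks of functions, so
      the set is carried over through its indicator.\<close>
    have "(indicator (?S B) :: _ \<Rightarrow> real) \<in> borel_measurable (M \<Otimes>\<^sub>M positive_time)"
      using \<xi>_minus_predictable by (intro predictable_to_product) auto
    then have "(indicator (?S B) :: _ \<Rightarrow> real) -` {1} \<inter> space (M \<Otimes>\<^sub>M positive_time) \<in> sets (M \<Otimes>\<^sub>M positive_time)"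
      by (intro measurable_sets[where A=borel]) auto
    also have "(indicator (?S B) :: _ \<Rightarrow> real) -` {1} \<inter> space (M \<Otimes>\<^sub>M positive_time) = ?S B"
      by (auto simp: space_pair_measure space_restrict_space indicator_def)
    finally show ?thesis .
  qed
  \<comment> \<open>The value \<open>None\<close> is handled as the complement of all genuine
    states, so it needs no description by jump times.\<close>
  have "(\<lambda>(\<omega>, u). \<xi>_minus u \<omega>) -` A \<inter> space (M \<Otimes>\<^sub>M positive_time)
    = ?S (Some -` A) \<union> (if None \<in> A then space (M \<Otimes>\<^sub>M positive_time) - ?S UNIV else {})"
  proof (rule set_eqI)
    fix x :: "'s path \<times> real"
    obtain \<omega> u where "x = (\<omega>, u)"
      by (cases x)
    then show "x \<in> (\<lambda>(\<omega>, u). \<xi>_minus u \<omega>) -` A \<inter> space (M \<Otimes>\<^sub>M positive_time) \<longleftrightarrow>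
      x \<in> ?S (Some -` A) \<union> (if None \<in> A then space (M \<Otimes>\<^sub>M positive_time) - ?S UNIV else {})"
      by (cases "\<xi>_minus u \<omega>") (auto simp: space_pair_measure space_restrict_space)
  qed
  also have "\<dots> \<in> sets (M \<Otimes>\<^sub>M positive_time)"
    using *[of "Some -` A"] *[of UNIV] by (intro sets.Un) (auto simp del: image_vimage_eq)
  finally show "(\<lambda>(\<omega>, u). \<xi>_minus u \<omega>) -` A \<inter> space (M \<Otimes>\<^sub>M positive_time) \<in> sets (M \<Otimes>\<^sub>M positive_time)" .
qed simp

text \<open>For a fixed state the integral is a measurable functional of the measure
  \<open>\<pi> \<omega> u\<close>; the state takes countably many values, so the left limit can be
  substituted afterwards.\<close>

lemma kernel_measurable:
  assumes "\<And>k. f k \<in> borel_measurable borel_infty"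
  shows "(\<lambda>(\<omega>, u). \<integral>\<^sup>+a. f (\<xi>_minus u \<omega>) a \<partial>\<pi> \<omega> u) \<in> borel_measurable (M \<Otimes>\<^sub>M positive_time)"
proof -
  have "(\<lambda>x. \<integral>\<^sup>+a. f k a \<partial>(case x of (\<omega>, u) \<Rightarrow> \<pi> \<omega> u)) \<in> borel_measurable (M \<Otimes>\<^sub>M positive_time)" for k
    by (rule measurable_compose[OF measurable_prob_algebraD[OF policy_measurable] nn_integral_measurable_subprob_algebra[OF assms]])
  from measurable_compose_countable[OF this \<xi>_minus_measurable] show ?thesis
    by (simp add: split_beta)
qed

lemma jump_rate_measurable:
  "(\<lambda>(x, j). jump_rate (fst x) (snd x) j) \<in> borel_measurable ((M \<Otimes>\<^sub>M positive_time) \<Otimes>\<^sub>M count_space UNIV)"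
proof -
  have "(\<lambda>x. jump_rate (fst x) (snd x) j) \<in> borel_measurable (M \<Otimes>\<^sub>M positive_time)" for j
    using kernel_measurable[of "\<lambda>k a. ennreal (off_rate Adm q j k a)"] off_rate_borel_measurable
    by (simp add: jump_rate_def split_beta)
  then show ?thesis
    by (intro measurable_pair_count_space) simp
qed

end

section \<open>The compensator formula\<close>

context ctmdp_process
begin

lemma section_measurable:
  assumes "\<omega> \<in> Omega"
  shows "(\<lambda>u. (\<omega>, u)) \<in> positive_time \<rightarrow>\<^sub>M predictable G"
proof (rule measurable_to_predictable)
  have "(\<lambda>u. u) \<in> positive_time \<rightarrow>\<^sub>M restrict_space borel {0..}"
    by (rule measurable_restrict_space2) (auto simp: space_restrict_space intro!: measurable_restrict_space1)
  then show "(\<lambda>u. (\<omega>, u)) \<in> positive_time \<rightarrow>\<^sub>M M \<Otimes>\<^sub>M restrict_space borel {0..}"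
    using assms by (intro measurable_Pair measurable_const) auto
qed

lemma mark_section_measurable:
  assumes "Y \<in> borel_measurable (predictable G \<Otimes>\<^sub>M count_space UNIV)" "\<omega> \<in> Omega"
  shows "(\<lambda>(u, j). Y ((\<omega>, u), j)) \<in> borel_measurable mark_space"
proof -
  have "(\<lambda>x. ((\<omega>, fst x), snd x)) \<in> mark_space \<rightarrow>\<^sub>M predictable G \<Otimes>\<^sub>M count_space UNIV"
    unfolding mark_space_def
    by (intro measurable_Pair measurable_compose[OF measurable_fst section_measurable[OF assms(2)]] measurable_snd)
  from measurable_compose[OF this assms(1)] show ?thesis
    by (simp add: split_beta)
qed

lemma jump_rate_section_measurable:
  assumes "\<omega> \<in> Omega"
  shows "(\<lambda>(u, j). jump_rate \<omega> u j) \<in> borel_measurable mark_space"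
proof -
  have "(\<lambda>u. (\<omega>, u)) \<in> positive_time \<rightarrow>\<^sub>M M \<Otimes>\<^sub>M positive_time"
    using assms by (intro measurable_Pair measurable_const) auto
  then have "(\<lambda>x. ((\<omega>, fst x), snd x)) \<in> mark_space \<rightarrow>\<^sub>M (M \<Otimes>\<^sub>M positive_time) \<Otimes>\<^sub>M count_space UNIV"
    unfolding mark_space_def
    by (rule measurable_Pair[OF measurable_compose[OF measurable_fst] measurable_snd])
  from measurable_compose[OF this jump_rate_measurable] show ?thesis
    by (simp add: split_beta)
qed

lemma nn_integral_jump_measure:
  assumes Y: "Y \<in> borel_measurable (predictable G \<Otimes>\<^sub>M count_space UNIV)" and "\<omega> \<in> Omega"
  shows "(\<integral>\<^sup>+(u, j). Y ((\<omega>, u), j) \<partial>jump_measure \<omega>)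
    = (\<Sum>m. Y ((\<omega>, enn2real (T (Suc m) \<omega>)), the (X (Suc m) \<omega>)) * indicator {m. T (Suc m) \<omega> < \<infinity>} m)"
proof -
  let ?S = "{m. 1 \<le> m \<and> T m \<omega> < \<infinity> \<and> X m \<omega> \<noteq> None}"
  let ?f = "\<lambda>m. (enn2real (T m \<omega>), the (X m \<omega>))"
  have "0 < enn2real (T m \<omega>)" if "m \<in> ?S" for m
    using T_strict_mono[OF assms(2), of 0 m] that by (auto simp: enn2real_positive_iff)
  then have f: "?f \<in> count_space ?S \<rightarrow>\<^sub>M mark_space"
    by (auto simp: mark_space_def space_pair_measure space_restrict_space)
  \<comment> \<open>Jumps are numbered from 1. Shifting the index leaves a series over all naturals
    whose indicator discards the infinite jump times, where \<open>enn2real\<close> and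
    \<open>the\<close> give meaningless defaults.\<close>
  have "bij_betw Suc {m. T (Suc m) \<omega> < \<infinity>} ?S"
  proof (intro bij_betwI[where g="\<lambda>m. m - 1"] funcsetI)
    show "Suc m \<in> ?S" if "m \<in> {m. T (Suc m) \<omega> < \<infinity>}" for m
      using T_eq_infty_iff[OF assms(2), of "Suc m"] that by (cases "X (Suc m) \<omega>") auto
  qed auto
  from nn_integral_bij_count_space[OF this, of "\<lambda>m. Y ((\<omega>, enn2real (T m \<omega>)), the (X m \<omega>))"] show ?thesis
    unfolding jump_measure_def
    by (subst nn_integral_distr[OF f])
      (auto simp: mark_section_measurable[OF assms] nn_integral_count_space_nat[symmetric]
        nn_integral_count_space_indicator)
qed

text \<open>The dual predictable projection property in the form used from here on: a series over
  the jumps on the left, an iterated time integral on the right. Both sides may be infinite.\<close>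

lemma compensator_formula:
  assumes Y: "Y \<in> borel_measurable (predictable G \<Otimes>\<^sub>M count_space UNIV)"
  shows "(\<integral>\<^sup>+\<omega>. (\<Sum>m. Y ((\<omega>, enn2real (T (Suc m) \<omega>)), the (X (Suc m) \<omega>)) * indicator {m. T (Suc m) \<omega> < \<infinity>} m) \<partial>M)
    = (\<integral>\<^sup>+\<omega>. \<integral>\<^sup>+u. \<integral>\<^sup>+j. Y ((\<omega>, u), j) * jump_rate \<omega> u j \<partial>count_space UNIV \<partial>positive_time \<partial>M)"
proof -
  have "(\<integral>\<^sup>+(u, j). Y ((\<omega>, u), j) \<partial>policy_compensator Adm q \<pi> \<omega>)
      = (\<integral>\<^sup>+u. \<integral>\<^sup>+j. Y ((\<omega>, u), j) * jump_rate \<omega> u j \<partial>count_space UNIV \<partial>positive_time)"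
    if "\<omega> \<in> Omega" for \<omega>
  proof -
    note meas = mark_section_measurable[OF Y that] jump_rate_section_measurable[OF that]
    from meas[unfolded split_beta'] have "(\<integral>\<^sup>+(u, j). Y ((\<omega>, u), j) \<partial>policy_compensator Adm q \<pi> \<omega>)
      = (\<integral>\<^sup>+(u, j). jump_rate \<omega> u j * Y ((\<omega>, u), j) \<partial>mark_space)"
      unfolding policy_compensator_eq
      by (subst nn_integral_density) (auto simp: split_beta' intro!: nn_integral_cong)
    also have "\<dots> = (\<integral>\<^sup>+u. \<integral>\<^sup>+j. jump_rate \<omega> u j * Y ((\<omega>, u), j) \<partial>count_space UNIV \<partial>positive_time)"
    proof -
      have "(\<lambda>(u, j). jump_rate \<omega> u j * Y ((\<omega>, u), j)) \<in> borel_measurable mark_space"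
        unfolding split_beta' using meas(2,1)[unfolded split_beta'] by (rule borel_measurable_times_ennreal)
      then show ?thesis
        unfolding mark_space_def
        by (subst sigma_finite_measure.nn_integral_fst[OF sigma_finite_measure_count_space, symmetric]) auto
    qed
    finally show ?thesis
      by (simp add: mult.commute)
  qed
  moreover have "(\<integral>\<^sup>+\<omega>. (\<integral>\<^sup>+(u, j). Y ((\<omega>, u), j) \<partial>jump_measure \<omega>) \<partial>M)
      = (\<integral>\<^sup>+\<omega>. (\<integral>\<^sup>+(u, j). Y ((\<omega>, u), j) \<partial>policy_compensator Adm q \<pi> \<omega>) \<partial>M)"
    using law Y unfolding policy_law_def dual_predictable_projection_def by blast
  moreover have "(\<integral>\<^sup>+\<omega>. (\<Sum>m. Y ((\<omega>, enn2real (T (Suc m) \<omega>)), the (X (Suc m) \<omega>)) * indicator {m. T (Suc m) \<omega> < \<infinity>} m) \<partial>M)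
      = (\<integral>\<^sup>+\<omega>. (\<integral>\<^sup>+(u, j). Y ((\<omega>, u), j) \<partial>jump_measure \<omega>) \<partial>M)"
    by (intro nn_integral_cong nn_integral_jump_measure[OF Y, symmetric]) simp
  moreover have "(\<integral>\<^sup>+\<omega>. \<integral>\<^sup>+u. \<integral>\<^sup>+j. Y ((\<omega>, u), j) * jump_rate \<omega> u j \<partial>count_space UNIV \<partial>positive_time \<partial>M)
      = (\<integral>\<^sup>+\<omega>. (\<integral>\<^sup>+(u, j). Y ((\<omega>, u), j) \<partial>policy_compensator Adm q \<pi> \<omega>) \<partial>M)"
    by (intro nn_integral_cong) (simp add: calculation(1))
  ultimately show ?thesis
    by simp
qed

text \<open>Interchanging the action integral with the sum over targets lets rate identities for a
  fixed action pass to the averaged intensities.\<close>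

lemma nn_integral_jump_rate:
  assumes "\<omega> \<in> Omega" "0 < u"
  shows "(\<integral>\<^sup>+j. g j * jump_rate \<omega> u j \<partial>count_space UNIV)
    = (\<integral>\<^sup>+a. \<integral>\<^sup>+j. g j * ennreal (off_rate Adm q j (\<xi>_minus u \<omega>) a) \<partial>count_space UNIV \<partial>\<pi> \<omega> u)"
proof -
  have [measurable]: "(\<lambda>a. ennreal (off_rate Adm q j k a)) \<in> borel_measurable (\<pi> \<omega> u)" for j k
    unfolding measurable_cong_sets[OF sets_policy[OF assms] refl]
    using off_rate_borel_measurable by (rule measurable_compose) simp
  show ?thesis
    unfolding jump_rate_def
    by (subst nn_integral_count_space_nn_integral) (auto simp: nn_integral_cmult)
qed

definition exit_intensity :: "'s path \<Rightarrow> real \<Rightarrow> ennreal" where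
  "exit_intensity \<omega> u = (\<integral>\<^sup>+j. jump_rate \<omega> u j \<partial>count_space UNIV)"

lemma exit_intensity_eq:
  assumes "\<omega> \<in> Omega" "0 < u"
  shows "exit_intensity \<omega> u = (\<integral>\<^sup>+a. ennreal (exit_rate Adm q (\<xi>_minus u \<omega>) a) \<partial>\<pi> \<omega> u)"
  using nn_integral_jump_rate[OF assms, of "\<lambda>_. 1"]
  by (simp add: exit_intensity_def nn_integral_off_rate)

lemma jump_rate_sum_measurable:
  "(\<lambda>(\<omega>, u). \<integral>\<^sup>+j. g j * jump_rate \<omega> u j \<partial>count_space UNIV) \<in> borel_measurable (M \<Otimes>\<^sub>M positive_time)"
proof -
  have "(\<lambda>x. jump_rate (fst x) (snd x) j) \<in> borel_measurable (M \<Otimes>\<^sub>M positive_time)" for j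
    using measurable_compose[OF _ jump_rate_measurable, of "\<lambda>x. (x, j)"] by simp
  then show ?thesis
    unfolding split_beta by (intro measurable_nn_integral_count_space borel_measurable_times_ennreal) auto
qed

lemma exit_intensity_measurable:
  "(\<lambda>(\<omega>, u). exit_intensity \<omega> u) \<in> borel_measurable (M \<Otimes>\<^sub>M positive_time)"
  using jump_rate_sum_measurable[of "\<lambda>_. 1"] by (simp add: exit_intensity_def)

text \<open>The only jump time a sojourn can contain is its own right end. This isolates a single
  term of the series in the compensator formula.\<close>

lemma jump_in_sojourn_iff:
  assumes "\<omega> \<in> Omega" "T (Suc n) \<omega> < \<infinity>"
  shows "(\<omega>, enn2real (T (Suc n) \<omega>)) \<in> sojourn m \<longleftrightarrow> n = m"
proof -
  have T: "ennreal (enn2real (T (Suc n) \<omega>)) = T (Suc n) \<omega>"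
    using assms(2) by (intro ennreal_enn2real) simp
  have less: "T n \<omega> < T (Suc n) \<omega>"
    using assms T_mono[of n "Suc n" \<omega>] by (intro T_less_T_Suc) (auto intro: le_less_trans)
  consider "n = m" | "n < m" | "m < n"
    by linarith
  then show ?thesis
  proof cases
    case 1
    with less T assms(1) show ?thesis
      by (simp add: sojourn_def)
  next
    case 2
    then show ?thesis
      using T_mono[of "Suc n" m \<omega>] by (auto simp: sojourn_def T)
  next
    case 3
    then have "T (Suc m) \<omega> < T (Suc n) \<omega>"
      using T_mono[of "Suc m" n \<omega>] less by (auto intro: le_less_trans)
    then show ?thesis
      using 3 by (auto simp: sojourn_def T)
  qed
qed

text \<open>Predictability is asked only of Z times the indicator, so Z may depend on the current
  state \<open>X m\<close>.\<close>

lemma compensator_formula_sojourn: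
  assumes "(\<lambda>(x, j). indicator (sojourn m) x * Z x j) \<in> borel_measurable (predictable G \<Otimes>\<^sub>M count_space UNIV)"
  shows "(\<integral>\<^sup>+\<omega>. Z (\<omega>, enn2real (T (Suc m) \<omega>)) (the (X (Suc m) \<omega>)) * indicator {\<omega>. T (Suc m) \<omega> < \<infinity>} \<omega> \<partial>M)
    = (\<integral>\<^sup>+\<omega>. \<integral>\<^sup>+u. indicator (sojourn m) (\<omega>, u) * (\<integral>\<^sup>+j. Z (\<omega>, u) j * jump_rate \<omega> u j \<partial>count_space UNIV) \<partial>positive_time \<partial>M)"
proof -
  have "(\<Sum>n. indicator (sojourn m) (\<omega>, enn2real (T (Suc n) \<omega>)) * Z (\<omega>, enn2real (T (Suc n) \<omega>)) (the (X (Suc n) \<omega>))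
        * indicator {m. T (Suc m) \<omega> < \<infinity>} n)
      = Z (\<omega>, enn2real (T (Suc m) \<omega>)) (the (X (Suc m) \<omega>)) * indicator {\<omega>. T (Suc m) \<omega> < \<infinity>} \<omega>"
    if "\<omega> \<in> Omega" for \<omega>
    using jump_in_sojourn_iff[OF that]
    by (subst suminf_finite[of "{m}"]) (auto simp: indicator_def)
  then have "(\<integral>\<^sup>+\<omega>. Z (\<omega>, enn2real (T (Suc m) \<omega>)) (the (X (Suc m) \<omega>)) * indicator {\<omega>. T (Suc m) \<omega> < \<infinity>} \<omega> \<partial>M)
    = (\<integral>\<^sup>+\<omega>. (\<Sum>n. indicator (sojourn m) (\<omega>, enn2real (T (Suc n) \<omega>)) * Z (\<omega>, enn2real (T (Suc n) \<omega>)) (the (X (Suc n) \<omega>))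
        * indicator {m. T (Suc m) \<omega> < \<infinity>} n) \<partial>M)"
    by (intro nn_integral_cong) simp
  then show ?thesis
    using compensator_formula[OF assms] by (simp add: nn_integral_cmult mult.assoc)
qed

end

section \<open>The weighted occupation bound\<close>

text \<open>The value 0 at infinity is the limit of exp(- \<alpha> x) for positive \<alpha>; it lets
  absorbed paths enter the weights without a case distinction.\<close>

definition disc :: "real \<Rightarrow> ennreal \<Rightarrow> ennreal" where
  "disc \<alpha> x = (if x = \<infinity> then 0 else ennreal (exp (- \<alpha> * enn2real x)))"

lemma measurable_disc [measurable]: "disc \<alpha> \<in> borel_measurable borel"
  unfolding disc_def[abs_def] by measurable

lemma measurable_positive_time: "f \<in> borel \<rightarrow>\<^sub>M N \<Longrightarrow> f \<in> positive_time \<rightarrow>\<^sub>M N"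
  by (rule measurable_restrict_space1) simp

lemma measurable_exp_positive_time [measurable]:
  "(\<lambda>u. ennreal (exp (a * u))) \<in> borel_measurable positive_time"
  "(\<lambda>x. ennreal (exp (a * snd x))) \<in> borel_measurable (N \<Otimes>\<^sub>M positive_time)"
proof -
  show *: "(\<lambda>u. ennreal (exp (a * u))) \<in> borel_measurable positive_time"
    by (rule measurable_positive_time) measurable
  from measurable_compose[OF measurable_snd this]
  show "(\<lambda>x. ennreal (exp (a * snd x))) \<in> borel_measurable (N \<Otimes>\<^sub>M positive_time)" .
qed

lemma measurable_exp_minus_positive_time [measurable]:
  "(\<lambda>u. ennreal (exp (- (a * u)))) \<in> borel_measurable positive_time"
  "(\<lambda>x. ennreal (exp (- (a * snd x)))) \<in> borel_measurable (N \<Otimes>\<^sub>M positive_time)"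
  using measurable_exp_positive_time[of "- a"] by simp_all

lemma measurable_indicator_positive_time [measurable]:
  "(indicator {u. x < ennreal u} :: real \<Rightarrow> ennreal) \<in> borel_measurable positive_time"
  by (rule measurable_positive_time) measurable

lemma nn_integral_exp_tail:
  assumes "0 < \<alpha>"
  shows "ennreal \<alpha> * (\<integral>\<^sup>+u. indicator {u. x < ennreal u} u * ennreal (exp (- \<alpha> * u)) \<partial>positive_time) = disc \<alpha> x"
proof (cases x)
  case top
  then show ?thesis
    by (simp add: disc_def)
next
  case (real p)
  have lim: "((\<lambda>u. - exp (- \<alpha> * u)) \<longlongrightarrow> 0) at_top"
    using tendsto_minus[OF filterlim_compose[OF exp_at_bot filterlim_tendsto_neg_mult_at_bot[OF tendsto_const _ filterlim_ident]], of "- \<alpha>"]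
      assms by simp
  have "ennreal \<alpha> * (\<integral>\<^sup>+u. indicator {u. x < ennreal u} u * ennreal (exp (- \<alpha> * u)) \<partial>positive_time)
      = (\<integral>\<^sup>+u. ennreal \<alpha> * (indicator {u. x < ennreal u} u * ennreal (exp (- \<alpha> * u))) \<partial>positive_time)"
    by (rule nn_integral_cmult[symmetric]) measurable
  also have "\<dots> = (\<integral>\<^sup>+u. ennreal \<alpha> * (indicator {u. x < ennreal u} u * ennreal (exp (- \<alpha> * u))) * indicator {0<..} u \<partial>lborel)"
    by (rule nn_integral_restrict_space) simp
  \<comment> \<open>The open ray is closed at p, which changes a null set, to fit the fundamental
    theorem of calculus on [p,\<infinity>).\<close>
  also have "\<dots> = (\<integral>\<^sup>+u. ennreal (\<alpha> * exp (- \<alpha> * u)) * indicator {p..} u \<partial>lborel)"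
  proof (rule nn_integral_cong_AE)
    show "AE u in lborel. ennreal \<alpha> * (indicator {u. x < ennreal u} u * ennreal (exp (- \<alpha> * u))) * indicator {0<..} u
        = ennreal (\<alpha> * exp (- \<alpha> * u)) * indicator {p..} u"
      using AE_lborel_singleton[of p]
      by eventually_elim (use real assms in \<open>auto simp: indicator_def ennreal_less_iff ennreal_mult\<close>)
  qed
  also have "\<dots> = ennreal (0 - (- exp (- \<alpha> * p)))"
    using assms lim
    by (intro nn_integral_FTC_atLeast) (auto intro!: derivative_eq_intros)
  finally show ?thesis
    using real by (simp add: disc_def)
qed

text \<open>Since \<open>w \<ge> 1\<close>, the additive constant \<open>b\<^sub>1\<close> is absorbed: \<open>c\<close> stands for \<open>\<rho>\<^sub>1 + b\<^sub>1\<close>.\<close>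

locale weighted_ctmdp_process = ctmdp_process Adm q \<pi> P i
  for Adm :: "'s::countable \<Rightarrow> 'a::polish_space set" and q \<pi> P i +
  fixes w :: "'s \<Rightarrow> real" and c L :: real
  assumes w_ge_1: "\<And>k. 1 \<le> w k" and c_nonneg: "0 \<le> c" and L_pos: "0 < L"
    and drift: "\<And>k a. a \<in> Adm k \<Longrightarrow>
          (\<lambda>j. w j * q j k a) summable_on UNIV \<and> (\<Sum>\<^sub>\<infinity>j. w j * q j k a) \<le> c * w k"
    and qstar_le: "\<And>k. qstar Adm q k \<le> L * w k"
begin

definition W :: "'s option \<Rightarrow> ennreal" where
  "W k = (case k of Some j \<Rightarrow> ennreal (w j) | None \<Rightarrow> 0)"

lemma W_simps [simp]: "W None = 0" "W (Some k) = ennreal (w k)"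
  by (simp_all add: W_def)

lemma w_nonneg: "0 \<le> w k"
  using w_ge_1[of k] by simp

lemma exit_rate_le_W: "ennreal (exit_rate Adm q k a) \<le> ennreal L * W k"
proof (cases k)
  case (Some j)
  have "exit_rate Adm q k a \<le> L * w j"
    unfolding Some using qstar_le[of j] L_pos w_nonneg[of j] by (intro exit_rate_le) auto
  then show ?thesis
    using Some L_pos w_nonneg[of j] by (simp add: ennreal_mult[symmetric] ennreal_leI)
qed (simp add: exit_rate_def)

lemma exit_intensity_le:
  assumes "\<omega> \<in> Omega" "0 < u"
  shows "exit_intensity \<omega> u \<le> ennreal L * W (\<xi>_minus u \<omega>)"
proof -
  have "exit_intensity \<omega> u \<le> (\<integral>\<^sup>+a. ennreal L * W (\<xi>_minus u \<omega>) \<partial>\<pi> \<omega> u)"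
    unfolding exit_intensity_eq[OF assms] by (intro nn_integral_mono exit_rate_le_W)
  then show ?thesis
    using prob_space.emeasure_space_1[OF prob_space_policy[OF assms]] by simp
qed

text \<open>The drift bound for a fixed action, averaged over the policy. The exit term is kept as
  it is instead of being bounded through L w, since nothing controls the expectation of w^2.\<close>

lemma weighted_jump_rate_le:
  assumes "\<omega> \<in> Omega" "0 < u"
  shows "(\<integral>\<^sup>+j. ennreal (w j) * jump_rate \<omega> u j \<partial>count_space UNIV)
    \<le> ennreal c * W (\<xi>_minus u \<omega>) + W (\<xi>_minus u \<omega>) * exit_intensity \<omega> u"
proof -
  have [measurable]: "(\<lambda>a. ennreal (exit_rate Adm q k a)) \<in> borel_measurable (\<pi> \<omega> u)" for k
    unfolding measurable_cong_sets[OF sets_policy[OF assms] refl]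
    using exit_rate_borel_measurable by (rule measurable_compose) simp
  have "(\<integral>\<^sup>+j. ennreal (w j) * ennreal (off_rate Adm q j k a) \<partial>count_space UNIV)
     \<le> ennreal c * W k + W k * ennreal (exit_rate Adm q k a)" for k a
  proof (cases k)
    case None
    then show ?thesis
      by (simp add: off_rate_def rate_def)
  next
    case (Some l)
    then show ?thesis
      using off_rate_drift[OF w_nonneg drift c_nonneg, of l a] by simp
  qed
  then have "(\<integral>\<^sup>+j. ennreal (w j) * jump_rate \<omega> u j \<partial>count_space UNIV)
     \<le> (\<integral>\<^sup>+a. ennreal c * W (\<xi>_minus u \<omega>) + W (\<xi>_minus u \<omega>) * ennreal (exit_rate Adm q (\<xi>_minus u \<omega>) a) \<partial>\<pi> \<omega> u)"
    unfolding nn_integral_jump_rate[OF assms] by (intro nn_integral_mono)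
  also have "\<dots> = ennreal c * W (\<xi>_minus u \<omega>) + W (\<xi>_minus u \<omega>) * exit_intensity \<omega> u"
    using prob_space.emeasure_space_1[OF prob_space_policy[OF assms]]
    by (subst nn_integral_add) (auto simp: nn_integral_cmult exit_intensity_eq[OF assms])
  finally show ?thesis .
qed

text \<open>The drift uses up c, and the remaining 1 produces the decrease: it leaves one copy of
  \<open>sojourn_weight\<close> over in \<open>weight_descent\<close>.\<close>

definition \<alpha> :: real where
  "\<alpha> = c + 1"

definition state_weight :: "nat \<Rightarrow> ennreal" where
  "state_weight m = (\<integral>\<^sup>+\<omega>. disc \<alpha> (T m \<omega>) * W (X m \<omega>) \<partial>M)"

text \<open>The old state weighed at the moment it is left. This is both what the discount leaves at
  the end of a sojourn and, by the compensator formula, the expected exit term of the drift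
  bound.\<close>

definition exit_weight :: "nat \<Rightarrow> ennreal" where
  "exit_weight m = (\<integral>\<^sup>+\<omega>. disc \<alpha> (T (Suc m) \<omega>) * W (X m \<omega>) \<partial>M)"

definition sojourn_weight :: "nat \<Rightarrow> ennreal" where
  "sojourn_weight m = (\<integral>\<^sup>+\<omega>. \<integral>\<^sup>+u. indicator (sojourn m) (\<omega>, u) * (ennreal (exp (- \<alpha> * u)) * W (X m \<omega>)) \<partial>positive_time \<partial>M)"

lemma sojourn_measurable [measurable]:
  "(indicator (sojourn m) :: _ \<Rightarrow> ennreal) \<in> borel_measurable (M \<Otimes>\<^sub>M positive_time)"
  using sojourn_in_predictable by (intro predictable_to_product) auto

lemma W_measurable [measurable]: "(\<lambda>\<omega>. W (X m \<omega>)) \<in> borel_measurable M"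
  by (rule measurable_compose[OF X_measurable_M]) simp

lemma nn_integral_positive_time_measurable:
  "(\<lambda>(\<omega>, u). f \<omega> u) \<in> borel_measurable (N \<Otimes>\<^sub>M positive_time) \<Longrightarrow>
    (\<lambda>\<omega>. \<integral>\<^sup>+u. f \<omega> u \<partial>positive_time) \<in> borel_measurable N"
  by (rule sigma_finite_measure.borel_measurable_nn_integral[OF sigma_finite_positive_time])

lemma section_product_measurable:
  "(\<lambda>(\<omega>, u). f \<omega> u) \<in> borel_measurable (M \<Otimes>\<^sub>M positive_time) \<Longrightarrow> \<omega> \<in> Omega \<Longrightarrow>
    (\<lambda>u. f \<omega> u) \<in> borel_measurable positive_time"
  using measurable_compose[OF measurable_Pair1'[of \<omega> M positive_time], of "\<lambda>(\<omega>, u). f \<omega> u"] by simp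

text \<open>The sojourn is the tail after \<open>T m\<close> without the tail after
  \<open>T (Suc m)\<close>. The additive form avoids subtraction and covers an infinite right end as
  well.\<close>

lemma disc_sojourn:
  assumes "\<omega> \<in> Omega"
  shows "ennreal \<alpha> * (\<integral>\<^sup>+u. indicator (sojourn m) (\<omega>, u) * ennreal (exp (- \<alpha> * u)) \<partial>positive_time)
    + disc \<alpha> (T (Suc m) \<omega>) = disc \<alpha> (T m \<omega>)"
proof -
  have pos: "0 < \<alpha>"
    using c_nonneg by (simp add: \<alpha>_def)
  have split: "indicator {u. T m \<omega> < ennreal u} u
      = (indicator (sojourn m) (\<omega>, u) + indicator {u. T (Suc m) \<omega> < ennreal u} u :: ennreal)" for u
    using assms T_mono[of m "Suc m" \<omega>] by (auto simp: sojourn_def indicator_def)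
  have [measurable]: "(\<lambda>u. indicator (sojourn m) (\<omega>, u) :: ennreal) \<in> borel_measurable positive_time"
    using assms by (intro section_product_measurable) simp
  show ?thesis
    unfolding nn_integral_exp_tail[OF pos, symmetric] split distrib_right
    by (subst nn_integral_add) (auto simp: distrib_left)
qed

lemma state_weight_eq: "state_weight m = ennreal \<alpha> * sojourn_weight m + exit_weight m"
proof -
  have "state_weight m = (\<integral>\<^sup>+\<omega>. ennreal \<alpha> * (\<integral>\<^sup>+u. indicator (sojourn m) (\<omega>, u) * (ennreal (exp (- \<alpha> * u)) * W (X m \<omega>)) \<partial>positive_time)
      + disc \<alpha> (T (Suc m) \<omega>) * W (X m \<omega>) \<partial>M)"
    unfolding state_weight_def
  proof (rule nn_integral_cong)
    fix \<omega> assume "\<omega> \<in> space M"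
    then have \<omega>: "\<omega> \<in> Omega" by simp
    have [measurable]: "(\<lambda>u. indicator (sojourn m) (\<omega>, u) :: ennreal) \<in> borel_measurable positive_time"
      using \<omega> by (intro section_product_measurable) simp
    have "(\<integral>\<^sup>+u. indicator (sojourn m) (\<omega>, u) * (ennreal (exp (- \<alpha> * u)) * W (X m \<omega>)) \<partial>positive_time)
        = (\<integral>\<^sup>+u. indicator (sojourn m) (\<omega>, u) * ennreal (exp (- \<alpha> * u)) \<partial>positive_time) * W (X m \<omega>)"
      by (subst nn_integral_multc[symmetric]) (auto simp: mult.assoc)
    then show "disc \<alpha> (T m \<omega>) * W (X m \<omega>)
      = ennreal \<alpha> * (\<integral>\<^sup>+u. indicator (sojourn m) (\<omega>, u) * (ennreal (exp (- \<alpha> * u)) * W (X m \<omega>)) \<partial>positive_time)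
      + disc \<alpha> (T (Suc m) \<omega>) * W (X m \<omega>)"
      unfolding disc_sojourn[OF \<omega>, of m, symmetric] by (simp add: distrib_right mult.assoc)
  qed
  also have "\<dots> = ennreal \<alpha> * sojourn_weight m + exit_weight m"
  proof -
    have "(\<lambda>\<omega>. \<integral>\<^sup>+u. indicator (sojourn m) (\<omega>, u) * (ennreal (exp (- \<alpha> * u)) * W (X m \<omega>)) \<partial>positive_time) \<in> borel_measurable M"
      by (rule nn_integral_positive_time_measurable) (simp add: split_beta')
    then show ?thesis
      unfolding sojourn_weight_def exit_weight_def
      by (subst nn_integral_add) (auto simp: nn_integral_cmult)
  qed
  finally show ?thesis .
qed

lemma sojourn_state_eq:
  assumes "(\<omega>, u) \<in> sojourn m"
  shows "\<xi>_minus u \<omega> = X m \<omega>"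
  using assms by (intro \<xi>_minus_eq) (auto simp: sojourn_def)

lemma predictable_exp:
  "(\<lambda>x. ennreal (exp (a * snd x))) \<in> borel_measurable (predictable G)"
  by measurable

text \<open>
  The exit term \<open>w(X\<^sub>m) q\<close> may be of order \<open>w\<^sup>2\<close>, but its discounted expectation is \<open>exit_weight m\<close>,
  which is bounded by \<open>state_weight m\<close> and cancels in \<open>weight_descent\<close>.
\<close>

lemma exit_weight_eq:
  "exit_weight m = (\<integral>\<^sup>+\<omega>. \<integral>\<^sup>+u. indicator (sojourn m) (\<omega>, u) *
      (ennreal (exp (- \<alpha> * u)) * W (X m \<omega>) * exit_intensity \<omega> u) \<partial>positive_time \<partial>M)"
proof -
  have "(\<lambda>x. ennreal (exp (- \<alpha> * snd x)) * (indicator (sojourn m) x * W (X m (fst x)))) \<in> borel_measurable (predictable G)"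
    by (rule borel_measurable_times_ennreal[OF predictable_exp X_measurable_sojourn])
  then have "(\<lambda>(x, j :: 's). indicator (sojourn m) x * (ennreal (exp (- \<alpha> * snd x)) * W (X m (fst x))))
      \<in> borel_measurable (predictable G \<Otimes>\<^sub>M count_space UNIV)"
    by (intro measurable_pair_count_space) (simp add: mult.left_commute)
  from compensator_formula_sojourn[OF this]
  have formula: "(\<integral>\<^sup>+\<omega>. ennreal (exp (- \<alpha> * enn2real (T (Suc m) \<omega>))) * W (X m \<omega>) * indicator {\<omega>. T (Suc m) \<omega> < \<infinity>} \<omega> \<partial>M)
    = (\<integral>\<^sup>+\<omega>. \<integral>\<^sup>+u. indicator (sojourn m) (\<omega>, u) *
      (\<integral>\<^sup>+j. ennreal (exp (- \<alpha> * u)) * W (X m \<omega>) * jump_rate \<omega> u j \<partial>count_space UNIV) \<partial>positive_time \<partial>M)"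
    by simp
  have rhs: "(\<integral>\<^sup>+j. ennreal (exp (- \<alpha> * u)) * W (X m \<omega>) * jump_rate \<omega> u j \<partial>count_space UNIV)
      = ennreal (exp (- \<alpha> * u)) * W (X m \<omega>) * exit_intensity \<omega> u" for \<omega> u
    by (simp add: exit_intensity_def nn_integral_cmult)
  have lhs: "(\<integral>\<^sup>+\<omega>. ennreal (exp (- \<alpha> * enn2real (T (Suc m) \<omega>))) * W (X m \<omega>) * indicator {\<omega>. T (Suc m) \<omega> < \<infinity>} \<omega> \<partial>M)
     = exit_weight m"
    unfolding exit_weight_def by (intro nn_integral_cong) (auto simp: disc_def indicator_def less_top)
  from formula show ?thesis
    unfolding lhs rhs .
qed

text \<open>The test function exp(- \<alpha> u) w(j) reads off the weight of the state just entered,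
  so the one jump that ends the sojourn contributes exactly the discounted weight of the next
  state.\<close>

lemma state_weight_Suc:
  "state_weight (Suc m) = (\<integral>\<^sup>+\<omega>. \<integral>\<^sup>+u. indicator (sojourn m) (\<omega>, u) *
      (ennreal (exp (- \<alpha> * u)) * (\<integral>\<^sup>+j. ennreal (w j) * jump_rate \<omega> u j \<partial>count_space UNIV)) \<partial>positive_time \<partial>M)"
proof -
  have "(\<lambda>x. indicator (sojourn m) x * (ennreal (exp (- \<alpha> * snd x)) * ennreal (w j))) \<in> borel_measurable (predictable G)" for j
    using sojourn_in_predictable predictable_exp by (intro borel_measurable_times_ennreal) auto
  then have "(\<lambda>(x, j). indicator (sojourn m) x * (ennreal (exp (- \<alpha> * snd x)) * ennreal (w j)))
      \<in> borel_measurable (predictable G \<Otimes>\<^sub>M count_space UNIV)"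
    by (intro measurable_pair_count_space) simp
  from compensator_formula_sojourn[OF this]
  have formula: "(\<integral>\<^sup>+\<omega>. ennreal (exp (- \<alpha> * enn2real (T (Suc m) \<omega>))) * ennreal (w (the (X (Suc m) \<omega>))) * indicator {\<omega>. T (Suc m) \<omega> < \<infinity>} \<omega> \<partial>M)
    = (\<integral>\<^sup>+\<omega>. \<integral>\<^sup>+u. indicator (sojourn m) (\<omega>, u) *
      (\<integral>\<^sup>+j. ennreal (exp (- \<alpha> * u)) * ennreal (w j) * jump_rate \<omega> u j \<partial>count_space UNIV) \<partial>positive_time \<partial>M)"
    by simp
  have rhs: "(\<integral>\<^sup>+j. ennreal (exp (- \<alpha> * u)) * ennreal (w j) * jump_rate \<omega> u j \<partial>count_space UNIV)
      = ennreal (exp (- \<alpha> * u)) * (\<integral>\<^sup>+j. ennreal (w j) * jump_rate \<omega> u j \<partial>count_space UNIV)" for \<omega> u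
    by (simp add: nn_integral_cmult[symmetric] mult.assoc)
  have lhs: "(\<integral>\<^sup>+\<omega>. ennreal (exp (- \<alpha> * enn2real (T (Suc m) \<omega>))) * ennreal (w (the (X (Suc m) \<omega>))) * indicator {\<omega>. T (Suc m) \<omega> < \<infinity>} \<omega> \<partial>M)
     = state_weight (Suc m)"
    unfolding state_weight_def
  proof (rule nn_integral_cong)
    fix \<omega> assume "\<omega> \<in> space M"
    then show "ennreal (exp (- \<alpha> * enn2real (T (Suc m) \<omega>))) * ennreal (w (the (X (Suc m) \<omega>))) * indicator {\<omega>. T (Suc m) \<omega> < \<infinity>} \<omega>
      = disc \<alpha> (T (Suc m) \<omega>) * W (X (Suc m) \<omega>)"
      using T_eq_infty_iff[of \<omega> "Suc m"] by (cases "X (Suc m) \<omega>") (auto simp: disc_def indicator_def less_top)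
  qed
  from formula show ?thesis
    unfolding lhs rhs .
qed

lemma exit_intensity_measurable' [measurable]:
  "(\<lambda>x. exit_intensity (fst x) (snd x)) \<in> borel_measurable (M \<Otimes>\<^sub>M positive_time)"
  using exit_intensity_measurable by (simp add: split_beta')

lemma weight_descent: "state_weight (Suc m) + sojourn_weight m \<le> state_weight m"
proof -
  let ?e = "\<lambda>u. ennreal (exp (- \<alpha> * u))"
  have meas1 [measurable]: "(\<lambda>(\<omega>, u). indicator (sojourn m) (\<omega>, u) * (?e u * W (X m \<omega>))) \<in> borel_measurable (M \<Otimes>\<^sub>M positive_time)"
    and meas2 [measurable]: "(\<lambda>(\<omega>, u). indicator (sojourn m) (\<omega>, u) * (?e u * W (X m \<omega>) * exit_intensity \<omega> u)) \<in> borel_measurable (M \<Otimes>\<^sub>M positive_time)"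
    unfolding split_beta' prod.collapse by measurable
  have "state_weight (Suc m) \<le> (\<integral>\<^sup>+\<omega>. \<integral>\<^sup>+u. ennreal c * (indicator (sojourn m) (\<omega>, u) * (?e u * W (X m \<omega>)))
      + indicator (sojourn m) (\<omega>, u) * (?e u * W (X m \<omega>) * exit_intensity \<omega> u) \<partial>positive_time \<partial>M)"
    unfolding state_weight_Suc
  proof (intro nn_integral_mono)
    fix \<omega> and u :: real assume "\<omega> \<in> space M" "u \<in> space positive_time"
    then have \<omega>: "\<omega> \<in> Omega" "0 < u"
      by (auto simp: space_restrict_space)
    show "indicator (sojourn m) (\<omega>, u) * (?e u * (\<integral>\<^sup>+j. ennreal (w j) * jump_rate \<omega> u j \<partial>count_space UNIV))
      \<le> ennreal c * (indicator (sojourn m) (\<omega>, u) * (?e u * W (X m \<omega>)))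
      + indicator (sojourn m) (\<omega>, u) * (?e u * W (X m \<omega>) * exit_intensity \<omega> u)"
    proof (cases "(\<omega>, u) \<in> sojourn m")
      case True
      have "?e u * (\<integral>\<^sup>+j. ennreal (w j) * jump_rate \<omega> u j \<partial>count_space UNIV)
          \<le> ?e u * (ennreal c * W (X m \<omega>) + W (X m \<omega>) * exit_intensity \<omega> u)"
        using weighted_jump_rate_le[OF \<omega>] sojourn_state_eq[OF True] by (intro mult_left_mono) auto
      then show ?thesis
        using True by (simp add: distrib_left mult_ac)
    qed simp
  qed
  also have "\<dots> = (\<integral>\<^sup>+\<omega>. ennreal c * (\<integral>\<^sup>+u. indicator (sojourn m) (\<omega>, u) * (?e u * W (X m \<omega>)) \<partial>positive_time)
      + (\<integral>\<^sup>+u. indicator (sojourn m) (\<omega>, u) * (?e u * W (X m \<omega>) * exit_intensity \<omega> u) \<partial>positive_time) \<partial>M)"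
  proof (rule nn_integral_cong)
    fix \<omega> assume "\<omega> \<in> space M"
    then have \<omega>: "\<omega> \<in> Omega" by simp
    show "(\<integral>\<^sup>+u. ennreal c * (indicator (sojourn m) (\<omega>, u) * (?e u * W (X m \<omega>)))
      + indicator (sojourn m) (\<omega>, u) * (?e u * W (X m \<omega>) * exit_intensity \<omega> u) \<partial>positive_time)
      = ennreal c * (\<integral>\<^sup>+u. indicator (sojourn m) (\<omega>, u) * (?e u * W (X m \<omega>)) \<partial>positive_time)
      + (\<integral>\<^sup>+u. indicator (sojourn m) (\<omega>, u) * (?e u * W (X m \<omega>) * exit_intensity \<omega> u) \<partial>positive_time)"
      using section_product_measurable[OF meas1 \<omega>] section_product_measurable[OF meas2 \<omega>]
      by (subst nn_integral_add) (auto simp: nn_integral_cmult)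
  qed
  also have "\<dots> = ennreal c * sojourn_weight m + exit_weight m"
    unfolding sojourn_weight_def exit_weight_eq
    using nn_integral_positive_time_measurable[OF meas1] nn_integral_positive_time_measurable[OF meas2]
    by (subst nn_integral_add) (auto simp: nn_integral_cmult)
  \<comment> \<open>One copy of \<open>sojourn_weight m\<close> is added on both sides: since c + 1
    is \<alpha>, the right side becomes \<open>state_weight m\<close> by
    \<open>state_weight_eq\<close>, and \<open>exit_weight m\<close> is never subtracted.\<close>
  finally have "state_weight (Suc m) + sojourn_weight m \<le> ennreal c * sojourn_weight m + exit_weight m + sojourn_weight m"
    by (rule add_right_mono)
  also have "\<dots> = state_weight m"
    unfolding state_weight_eq[of m] \<alpha>_def using c_nonneg by (simp add: ennreal_plus distrib_right add_ac)
  finally show ?thesis .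
qed

lemma sum_sojourn_weight: "state_weight n + (\<Sum>m<n. sojourn_weight m) \<le> state_weight 0"
proof (induction n)
  case (Suc n)
  have "state_weight (Suc n) + (\<Sum>m<Suc n. sojourn_weight m)
      = state_weight (Suc n) + sojourn_weight n + (\<Sum>m<n. sojourn_weight m)"
    by (simp add: add_ac)
  also have "\<dots> \<le> state_weight n + (\<Sum>m<n. sojourn_weight m)"
    using weight_descent by (rule add_right_mono)
  finally show ?case
    using Suc by (rule order_trans)
qed simp

lemma AE_X_0: "AE \<omega> in M. X 0 \<omega> = Some i"
proof -
  have "measure P {\<omega> \<in> Omega. \<xi> 0 \<omega> = Some i} = 1"
    using law by (simp add: policy_law_def)
  moreover have "{\<omega> \<in> Omega. \<xi> 0 \<omega> = Some i} = {\<omega> \<in> space P. X 0 \<omega> = Some i}"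
    by (auto simp: \<xi>_0)
  moreover have "Measurable.pred P (\<lambda>\<omega>. X 0 \<omega> = Some i)"
    unfolding measurable_cong_sets[OF sets_P refl] by measurable
  then have "{\<omega> \<in> space P. X 0 \<omega> = Some i} \<in> sets P"
    by (rule predE)
  ultimately have "AE \<omega> in P. X 0 \<omega> = Some i"
    using P.prob_Collect_eq_1[of "\<lambda>\<omega>. X 0 \<omega> = Some i"] by (simp del: space_P)
  then show ?thesis
    by (rule AE_completion)
qed

lemma state_weight_0: "state_weight 0 = ennreal (w i)"
proof -
  have "state_weight 0 = (\<integral>\<^sup>+\<omega>. ennreal (w i) \<partial>M)"
    unfolding state_weight_def
    by (rule nn_integral_cong_AE, use AE_X_0 in eventually_elim) (simp add: disc_def)
  then show ?thesis
    using M.emeasure_space_1 by simp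
qed

lemma suminf_sojourn_weight: "(\<Sum>m. sojourn_weight m) \<le> ennreal (w i)"
proof (rule suminf_le_const)
  fix n
  have "(\<Sum>m<n. sojourn_weight m) \<le> state_weight n + (\<Sum>m<n. sojourn_weight m)"
    by simp
  also have "\<dots> \<le> ennreal (w i)"
    using sum_sojourn_weight state_weight_0 by simp
  finally show "(\<Sum>m<n. sojourn_weight m) \<le> ennreal (w i)" .
qed simp

end

section \<open>A divergent series, and the balance of entries and exits along a path\<close>

lemma suminf_const_ennreal:
  fixes d :: ennreal
  assumes "d \<noteq> 0"
  shows "(\<Sum>m::nat. d) = \<infinity>"
  using assms by (simp add: nn_integral_count_space_nat[symmetric] ennreal_mult_top)

text \<open>Entries into A and exits from A alternate, so their numbers differ by the change of the
  indicator. Exits stand on the other side of the equation to avoid subtraction in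
  \<open>ennreal\<close>.\<close>

lemma telescope_enter_leave:
  fixes x :: "nat \<Rightarrow> 'b"
  assumes "k \<le> n"
  shows "(\<Sum>m=k..<n. indicator (- A) (x m) * indicator A (x (Suc m))) + indicator A (x k)
    = (\<Sum>m=k..<n. indicator A (x m) * indicator (- A) (x (Suc m))) + (indicator A (x n) :: ennreal)"
  using assms
proof (induction n rule: dec_induct)
  case (step n)
  have "(\<Sum>m=k..<Suc n. indicator (- A) (x m) * indicator A (x (Suc m))) + indicator A (x k)
    = ((\<Sum>m=k..<n. indicator (- A) (x m) * indicator A (x (Suc m))) + indicator A (x k))
      + (indicator (- A) (x n) * indicator A (x (Suc n)) :: ennreal)"
    using step.hyps by (simp add: add_ac)
  also have "\<dots> = (\<Sum>m=k..<n. indicator A (x m) * indicator (- A) (x (Suc m)))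
      + (indicator A (x n) + indicator (- A) (x n) * indicator A (x (Suc n)))"
    unfolding step.IH by (simp add: add_ac)
  also have "indicator A (x n) + indicator (- A) (x n) * indicator A (x (Suc n))
      = (indicator A (x n) * indicator (- A) (x (Suc n)) + indicator A (x (Suc n)) :: ennreal)"
    by (simp add: indicator_def)
  finally show ?case
    using step.hyps by (simp add: add_ac)
qed simp

text \<open>Without explosion s and t both lie between consecutive jump times, so only finitely many
  jumps fall into (s,t] and the telescoping applies.\<close>

lemma jump_count_balance:
  fixes \<omega> :: "'s path"
  assumes \<omega>: "\<omega> \<in> Omega" and nonexplosive: "T_infty \<omega> = \<infinity>" and times: "0 \<le> s" "s < t"
  defines "J \<equiv> {x. ennreal s < x \<and> x \<le> ennreal t}"
  shows "(\<Sum>m. indicator J (T (Suc m) \<omega>) * (indicator (- A) (X m \<omega>) * indicator A (X (Suc m) \<omega>))) + indicator A (\<xi> s \<omega>)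
    = (\<Sum>m. indicator J (T (Suc m) \<omega>) * (indicator A (X m \<omega>) * indicator (- A) (X (Suc m) \<omega>))) + (indicator A (\<xi> t \<omega>) :: ennreal)"
proof -
  obtain k where k: "T k \<omega> \<le> ennreal s" "ennreal s < T (Suc k) \<omega>"
    using ex_T_interval'[of s \<omega>] nonexplosive by auto
  obtain n where n: "T n \<omega> \<le> ennreal t" "ennreal t < T (Suc n) \<omega>"
    using ex_T_interval'[of t \<omega>] nonexplosive by auto
  \<comment> \<open>The jump at \<open>T (Suc m)\<close> leads from \<open>X m\<close> to
    \<open>X (Suc m)\<close>. The first jump after s is number k + 1 and the last one up to t is
    number n, whence m runs from k to n - 1.\<close>
  have J: "T (Suc m) \<omega> \<in> J \<longleftrightarrow> m \<in> {k..<n}" for m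
  proof -
    have "ennreal s < T (Suc m) \<omega> \<longleftrightarrow> k \<le> m"
      using k T_mono[of "Suc k" "Suc m" \<omega>] T_mono[of "Suc m" k \<omega>]
      by (cases "k \<le> m") (auto simp: not_le)
    moreover have "T (Suc m) \<omega> \<le> ennreal t \<longleftrightarrow> m < n"
      using n T_mono[of "Suc n" "Suc m" \<omega>] T_mono[of "Suc m" n \<omega>]
      by (cases "m < n") (auto simp: not_less)
    ultimately show ?thesis
      by (simp add: J_def)
  qed
  have "\<not> n < k"
  proof
    assume "n < k"
    then have "ennreal t < ennreal s"
      using n(2) T_mono[of "Suc n" k \<omega>] k(1) by simp
    then show False
      using times by (simp add: ennreal_less_iff)
  qed
  have sum: "(\<Sum>m. indicator J (T (Suc m) \<omega>) * f m) = (\<Sum>m=k..<n. f m)" for f :: "nat \<Rightarrow> ennreal"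
    using J by (subst suminf_finite[of "{k..<n}"]) (auto simp: indicator_def)
  show ?thesis
    unfolding sum \<xi>_eq[OF k] \<xi>_eq[OF n]
    using telescope_enter_leave[of k n A "\<lambda>m. X m \<omega>"] \<open>\<not> n < k\<close> by simp
qed

section \<open>Nonexplosion and expected occupation up to a fixed time\<close>

context weighted_ctmdp_process
begin

text \<open>The compensator formula with the unweighted test function exp(- \<alpha> u): at most one
  jump per sojourn, and on the sojourn the exit intensity is at most L w.\<close>

lemma nn_integral_disc_T: "(\<integral>\<^sup>+\<omega>. disc \<alpha> (T (Suc m) \<omega>) \<partial>M) \<le> ennreal L * sojourn_weight m"
proof -
  have "(\<lambda>x. indicator (sojourn m) x * ennreal (exp (- \<alpha> * snd x))) \<in> borel_measurable (predictable G)"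
    using sojourn_in_predictable predictable_exp by (intro borel_measurable_times_ennreal) auto
  then have "(\<lambda>(x, j :: 's). indicator (sojourn m) x * ennreal (exp (- \<alpha> * snd x)))
      \<in> borel_measurable (predictable G \<Otimes>\<^sub>M count_space UNIV)"
    by (intro measurable_pair_count_space) simp
  from compensator_formula_sojourn[OF this]
  have formula: "(\<integral>\<^sup>+\<omega>. ennreal (exp (- \<alpha> * enn2real (T (Suc m) \<omega>))) * indicator {\<omega>. T (Suc m) \<omega> < \<infinity>} \<omega> \<partial>M)
    = (\<integral>\<^sup>+\<omega>. \<integral>\<^sup>+u. indicator (sojourn m) (\<omega>, u) *
      (\<integral>\<^sup>+j. ennreal (exp (- \<alpha> * u)) * jump_rate \<omega> u j \<partial>count_space UNIV) \<partial>positive_time \<partial>M)"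
    by simp
  have lhs: "(\<integral>\<^sup>+\<omega>. ennreal (exp (- \<alpha> * enn2real (T (Suc m) \<omega>))) * indicator {\<omega>. T (Suc m) \<omega> < \<infinity>} \<omega> \<partial>M)
     = (\<integral>\<^sup>+\<omega>. disc \<alpha> (T (Suc m) \<omega>) \<partial>M)"
    by (intro nn_integral_cong) (auto simp: disc_def indicator_def less_top)
  have rhs: "(\<integral>\<^sup>+j. ennreal (exp (- \<alpha> * u)) * jump_rate \<omega> u j \<partial>count_space UNIV)
      = ennreal (exp (- \<alpha> * u)) * exit_intensity \<omega> u" for \<omega> u
    by (simp add: exit_intensity_def nn_integral_cmult)
  have "(\<integral>\<^sup>+\<omega>. disc \<alpha> (T (Suc m) \<omega>) \<partial>M)
    \<le> (\<integral>\<^sup>+\<omega>. \<integral>\<^sup>+u. ennreal L * (indicator (sojourn m) (\<omega>, u) * (ennreal (exp (- \<alpha> * u)) * W (X m \<omega>))) \<partial>positive_time \<partial>M)"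
    unfolding formula[unfolded lhs rhs]
  proof (intro nn_integral_mono)
    fix \<omega> and u :: real assume "\<omega> \<in> space M" "u \<in> space positive_time"
    then have \<omega>: "\<omega> \<in> Omega" "0 < u"
      by (auto simp: space_restrict_space)
    show "indicator (sojourn m) (\<omega>, u) * (ennreal (exp (- \<alpha> * u)) * exit_intensity \<omega> u)
        \<le> ennreal L * (indicator (sojourn m) (\<omega>, u) * (ennreal (exp (- \<alpha> * u)) * W (X m \<omega>)))"
    proof (cases "(\<omega>, u) \<in> sojourn m")
      case True
      have "ennreal (exp (- \<alpha> * u)) * exit_intensity \<omega> u \<le> ennreal (exp (- \<alpha> * u)) * (ennreal L * W (X m \<omega>))"
        using exit_intensity_le[OF \<omega>] sojourn_state_eq[OF True] by (intro mult_left_mono) auto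
      then show ?thesis
        using True by (simp add: mult_ac)
    qed simp
  qed
  also have "\<dots> = ennreal L * sojourn_weight m"
  proof -
    have meas: "(\<lambda>(\<omega>, u). indicator (sojourn m) (\<omega>, u) * (ennreal (exp (- \<alpha> * u)) * W (X m \<omega>))) \<in> borel_measurable (M \<Otimes>\<^sub>M positive_time)"
      unfolding split_beta' prod.collapse by measurable
    have "(\<integral>\<^sup>+u. ennreal L * (indicator (sojourn m) (\<omega>, u) * (ennreal (exp (- \<alpha> * u)) * W (X m \<omega>))) \<partial>positive_time)
      = ennreal L * (\<integral>\<^sup>+u. indicator (sojourn m) (\<omega>, u) * (ennreal (exp (- \<alpha> * u)) * W (X m \<omega>)) \<partial>positive_time)"
      if "\<omega> \<in> Omega" for \<omega>
      using section_product_measurable[OF meas that] by (rule nn_integral_cmult)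
    then have "(\<integral>\<^sup>+\<omega>. \<integral>\<^sup>+u. ennreal L * (indicator (sojourn m) (\<omega>, u) * (ennreal (exp (- \<alpha> * u)) * W (X m \<omega>))) \<partial>positive_time \<partial>M)
      = (\<integral>\<^sup>+\<omega>. ennreal L * (\<integral>\<^sup>+u. indicator (sojourn m) (\<omega>, u) * (ennreal (exp (- \<alpha> * u)) * W (X m \<omega>)) \<partial>positive_time) \<partial>M)"
      by (intro nn_integral_cong) simp
    also have "\<dots> = ennreal L * sojourn_weight m"
      unfolding sojourn_weight_def using nn_integral_positive_time_measurable[OF meas] by (rule nn_integral_cmult)
    finally show ?thesis .
  qed
  finally show ?thesis .
qed

text \<open>The discounted number of jumps has finite expectation, whereas explosion at a finite
  time would give infinitely many terms bounded below by the positive number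
  \<open>disc \<alpha> (T_infty \<omega>)\<close>.\<close>

lemma AE_nonexplosive: "AE \<omega> in M. T_infty \<omega> = \<infinity>"
proof -
  have "(\<integral>\<^sup>+\<omega>. (\<Sum>m. disc \<alpha> (T (Suc m) \<omega>)) \<partial>M) = (\<Sum>m. \<integral>\<^sup>+\<omega>. disc \<alpha> (T (Suc m) \<omega>) \<partial>M)"
    by (intro nn_integral_suminf) measurable
  also have "\<dots> \<le> (\<Sum>m. ennreal L * sojourn_weight m)"
    by (intro suminf_le nn_integral_disc_T) auto
  also have "\<dots> = ennreal L * (\<Sum>m. sojourn_weight m)"
    by simp
  also have "\<dots> \<le> ennreal L * ennreal (w i)"
    using suminf_sojourn_weight by (rule mult_left_mono) simp
  also have "\<dots> < \<infinity>"
    by (simp add: ennreal_mult_less_top)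
  finally have "AE \<omega> in M. (\<Sum>m. disc \<alpha> (T (Suc m) \<omega>)) \<noteq> \<infinity>"
    by (intro nn_integral_noteq_infinite) auto
  then show ?thesis
  proof eventually_elim
    case (elim \<omega>)
    show ?case
    proof (rule ccontr)
      assume finite: "T_infty \<omega> \<noteq> \<infinity>"
      have "disc \<alpha> (T_infty \<omega>) \<le> disc \<alpha> (T (Suc m) \<omega>)" for m
      proof -
        have "T (Suc m) \<omega> \<noteq> \<infinity>"
          using finite T_le_T_infty[of "Suc m" \<omega>] by (auto simp: top_unique)
        moreover have "enn2real (T (Suc m) \<omega>) \<le> enn2real (T_infty \<omega>)"
          using finite T_le_T_infty[of "Suc m" \<omega>] by (intro enn2real_mono) (auto simp: less_top)
        ultimately show ?thesis
          using finite c_nonneg unfolding disc_def by (simp add: \<alpha>_def mult_left_mono)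
      qed
      then have "(\<Sum>m. disc \<alpha> (T_infty \<omega>)) \<le> (\<Sum>m. disc \<alpha> (T (Suc m) \<omega>))"
        by (intro suminf_le) auto
      moreover have "(\<Sum>m::nat. disc \<alpha> (T_infty \<omega>)) = \<infinity>"
        using finite by (intro suminf_const_ennreal) (simp add: disc_def)
      ultimately show False
        using elim by (simp only: infinity_ennreal_def top_unique)
    qed
  qed
qed

lemma \<xi>_minus_W_measurable [measurable]:
  "(\<lambda>x. W (\<xi>_minus (snd x) (fst x))) \<in> borel_measurable (M \<Otimes>\<^sub>M positive_time)"
  using measurable_compose[OF \<xi>_minus_measurable, of W borel] by (simp add: split_beta')

lemma expected_occupation_finite:
  "(\<integral>\<^sup>+\<omega>. \<integral>\<^sup>+u. indicator {..t} u * W (\<xi>_minus u \<omega>) \<partial>positive_time \<partial>M) < \<infinity>"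
proof -
  let ?f = "\<lambda>m \<omega> u. indicator (sojourn m) (\<omega>, u) * (ennreal (exp (- \<alpha> * u)) * W (X m \<omega>))"
  have meas: "(\<lambda>(\<omega>, u). ?f m \<omega> u) \<in> borel_measurable (M \<Otimes>\<^sub>M positive_time)" for m
    unfolding split_beta' prod.collapse by measurable
  have sum_meas: "(\<lambda>(\<omega>, u). \<Sum>m. ?f m \<omega> u) \<in> borel_measurable (M \<Otimes>\<^sub>M positive_time)"
    using meas unfolding split_beta' by (intro borel_measurable_suminf_order)
  have "(\<integral>\<^sup>+\<omega>. \<integral>\<^sup>+u. indicator {..t} u * W (\<xi>_minus u \<omega>) \<partial>positive_time \<partial>M)
    \<le> (\<integral>\<^sup>+\<omega>. \<integral>\<^sup>+u. ennreal (exp (\<alpha> * t)) * (\<Sum>m. ?f m \<omega> u) \<partial>positive_time \<partial>M)"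
  proof (intro nn_integral_mono)
    fix \<omega> and u :: real assume "\<omega> \<in> space M" "u \<in> space positive_time"
    then have \<omega>: "\<omega> \<in> Omega" "0 < u"
      by (auto simp: space_restrict_space)
    show "indicator {..t} u * W (\<xi>_minus u \<omega>) \<le> ennreal (exp (\<alpha> * t)) * (\<Sum>m. ?f m \<omega> u)"
    \<comment> \<open>Once the left limit is \<open>None\<close> its weight is 0. Otherwise u
      belongs to some sojourn, whose single term of the series suffices.\<close>
    proof (cases "u \<le> t \<and> \<xi>_minus u \<omega> \<noteq> None")
      case True
      then obtain m where m: "(\<omega>, u) \<in> sojourn m"
        using \<omega> \<xi>_minus_eq_Some_iff[OF \<omega>] by (auto simp: sojourn_def)
      \<comment> \<open>Undoing the discount up to time t costs the constant factor exp(\<alpha>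
        t).\<close>
      have "\<alpha> * u \<le> \<alpha> * t"
        using True c_nonneg by (intro mult_left_mono) (auto simp: \<alpha>_def)
      then have "1 \<le> exp (\<alpha> * t) * exp (- \<alpha> * u)"
        by (simp add: exp_add[symmetric])
      then have "1 \<le> ennreal (exp (\<alpha> * t)) * ennreal (exp (- \<alpha> * u))"
        by (simp add: ennreal_mult[symmetric])
      then have "1 * W (X m \<omega>) \<le> ennreal (exp (\<alpha> * t)) * ennreal (exp (- \<alpha> * u)) * W (X m \<omega>)"
        by (rule mult_right_mono) simp
      also have "\<dots> = ennreal (exp (\<alpha> * t)) * ?f m \<omega> u"
        using m by (simp add: mult.assoc)
      also have "?f m \<omega> u = sum (\<lambda>m. ?f m \<omega> u) {m}"
        by (simp only: sum.insert finite.emptyI empty_iff not_False_eq_True sum.empty add_0_right)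
      also have "\<dots> \<le> (\<Sum>m. ?f m \<omega> u)"
        by (rule sum_le_suminf) auto
      finally show ?thesis
        using True sojourn_state_eq[OF m] by (simp add: mult_left_mono)
    qed (auto simp: indicator_def)
  qed
  also have "\<dots> = ennreal (exp (\<alpha> * t)) * (\<integral>\<^sup>+\<omega>. \<integral>\<^sup>+u. (\<Sum>m. ?f m \<omega> u) \<partial>positive_time \<partial>M)"
  proof -
    have "(\<integral>\<^sup>+u. ennreal (exp (\<alpha> * t)) * (\<Sum>m. ?f m \<omega> u) \<partial>positive_time)
      = ennreal (exp (\<alpha> * t)) * (\<integral>\<^sup>+u. (\<Sum>m. ?f m \<omega> u) \<partial>positive_time)" if "\<omega> \<in> Omega" for \<omega>
      using section_product_measurable[OF sum_meas that] by (rule nn_integral_cmult)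
    then have "(\<integral>\<^sup>+\<omega>. \<integral>\<^sup>+u. ennreal (exp (\<alpha> * t)) * (\<Sum>m. ?f m \<omega> u) \<partial>positive_time \<partial>M)
      = (\<integral>\<^sup>+\<omega>. ennreal (exp (\<alpha> * t)) * (\<integral>\<^sup>+u. (\<Sum>m. ?f m \<omega> u) \<partial>positive_time) \<partial>M)"
      by (intro nn_integral_cong) simp
    also have "\<dots> = ennreal (exp (\<alpha> * t)) * (\<integral>\<^sup>+\<omega>. \<integral>\<^sup>+u. (\<Sum>m. ?f m \<omega> u) \<partial>positive_time \<partial>M)"
      using nn_integral_positive_time_measurable[OF sum_meas] by (rule nn_integral_cmult)
    finally show ?thesis .
  qed
  also have "(\<integral>\<^sup>+\<omega>. \<integral>\<^sup>+u. (\<Sum>m. ?f m \<omega> u) \<partial>positive_time \<partial>M) = (\<Sum>m. sojourn_weight m)"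
  proof -
    have "(\<integral>\<^sup>+u. (\<Sum>m. ?f m \<omega> u) \<partial>positive_time) = (\<Sum>m. \<integral>\<^sup>+u. ?f m \<omega> u \<partial>positive_time)" if "\<omega> \<in> Omega" for \<omega>
      using section_product_measurable[OF meas that] by (rule nn_integral_suminf)
    then have "(\<integral>\<^sup>+\<omega>. \<integral>\<^sup>+u. (\<Sum>m. ?f m \<omega> u) \<partial>positive_time \<partial>M) = (\<integral>\<^sup>+\<omega>. (\<Sum>m. \<integral>\<^sup>+u. ?f m \<omega> u \<partial>positive_time) \<partial>M)"
      by (intro nn_integral_cong) simp
    also have "\<dots> = (\<Sum>m. sojourn_weight m)"
      unfolding sojourn_weight_def using nn_integral_positive_time_measurable[OF meas] by (rule nn_integral_suminf)
    finally show ?thesis .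
  qed
  also have "ennreal (exp (\<alpha> * t)) * (\<Sum>m. sojourn_weight m) \<le> ennreal (exp (\<alpha> * t)) * ennreal (w i)"
    using suminf_sojourn_weight by (rule mult_left_mono) simp
  also have "\<dots> < \<infinity>"
    by (simp add: ennreal_mult_less_top)
  finally show ?thesis .
qed

end

section \<open>Flows into and out of a set of states\<close>

context ctmdp_process
begin

text \<open>Both flows refer to the left limit, as the compensator does. At each time at most one of
  \<open>inflow\<close> and \<open>outflow\<close> is nonzero, and together they encode the signed
  policy average of q(B|k,a) at the left limit k.\<close>

definition inflow :: "'s set \<Rightarrow> 's path \<Rightarrow> real \<Rightarrow> ennreal" where
  "inflow B \<omega> u = indicator (- Some ` B) (\<xi>_minus u \<omega>) * (\<integral>\<^sup>+j. indicator B j * jump_rate \<omega> u j \<partial>count_space UNIV)"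

definition outflow :: "'s set \<Rightarrow> 's path \<Rightarrow> real \<Rightarrow> ennreal" where
  "outflow B \<omega> u = indicator (Some ` B) (\<xi>_minus u \<omega>) * (\<integral>\<^sup>+j. indicator (- B) j * jump_rate \<omega> u j \<partial>count_space UNIV)"

lemma
  shows inflow_measurable: "(\<lambda>(\<omega>, u). inflow B \<omega> u) \<in> borel_measurable (M \<Otimes>\<^sub>M positive_time)"
    and outflow_measurable: "(\<lambda>(\<omega>, u). outflow B \<omega> u) \<in> borel_measurable (M \<Otimes>\<^sub>M positive_time)"
proof -
  have ind: "(\<lambda>(\<omega>, u). indicator A (\<xi>_minus u \<omega>) :: ennreal) \<in> borel_measurable (M \<Otimes>\<^sub>M positive_time)" for A
    using measurable_compose[OF \<xi>_minus_measurable, of "indicator A :: _ \<Rightarrow> ennreal" borel] by (simp add: split_beta')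
  show "(\<lambda>(\<omega>, u). inflow B \<omega> u) \<in> borel_measurable (M \<Otimes>\<^sub>M positive_time)"
    using borel_measurable_times_ennreal[OF ind jump_rate_sum_measurable] unfolding inflow_def split_beta' .
  show "(\<lambda>(\<omega>, u). outflow B \<omega> u) \<in> borel_measurable (M \<Otimes>\<^sub>M positive_time)"
    using borel_measurable_times_ennreal[OF ind jump_rate_sum_measurable] unfolding outflow_def split_beta' .
qed

lemma
  shows inflow_le_exit_intensity: "inflow B \<omega> u \<le> exit_intensity \<omega> u"
    and outflow_le_exit_intensity: "outflow B \<omega> u \<le> exit_intensity \<omega> u"
  unfolding inflow_def outflow_def exit_intensity_def
  by (auto simp: indicator_def intro!: nn_integral_mono)

text \<open>The sign of the integrand is fixed by the state, so the Bochner integral is, up to sign,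
  one nonnegative integral. Integrability is not an issue: divergence gives 0 on both sides, once as
  a Bochner integral and once through \<open>enn2real\<close>.\<close>

lemma integral_rate_set:
  assumes "\<omega> \<in> Omega" "0 < u"
  shows "(LINT a|\<pi> \<omega> u. rate_set Adm q B (\<xi>_minus u \<omega>) a) = enn2real (inflow B \<omega> u) - enn2real (outflow B \<omega> u)"
proof -
  let ?k = "\<xi>_minus u \<omega>"
  have [measurable]: "(\<lambda>a. ennreal (off_rate Adm q j k a)) \<in> borel_measurable (\<pi> \<omega> u)" for j k
    unfolding measurable_cong_sets[OF sets_policy[OF assms] refl]
    using off_rate_borel_measurable by (rule measurable_compose) simp
  have meas: "(\<lambda>a. \<integral>\<^sup>+j. ennreal (off_rate Adm q j ?k a) * indicator A j \<partial>count_space UNIV) \<in> borel_measurable (\<pi> \<omega> u)" for A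
    by (intro measurable_nn_integral_count_space) measurable
  have flow: "(\<integral>\<^sup>+a. \<integral>\<^sup>+j. ennreal (off_rate Adm q j ?k a) * indicator A j \<partial>count_space UNIV \<partial>\<pi> \<omega> u)
      = (\<integral>\<^sup>+j. indicator A j * jump_rate \<omega> u j \<partial>count_space UNIV)" for A
    unfolding nn_integral_jump_rate[OF assms] by (simp add: mult.commute)
  show ?thesis
  proof (cases "?k \<in> Some ` B")
    case False
    note rate = ennreal_rate_set(1,3)[OF False]
    have "rate_set Adm q B ?k = (\<lambda>a. enn2real (\<integral>\<^sup>+j. ennreal (off_rate Adm q j ?k a) * indicator B j \<partial>count_space UNIV))"
      using rate by (simp add: rate(1)[symmetric] fun_eq_iff)
    then have "rate_set Adm q B ?k \<in> borel_measurable (\<pi> \<omega> u)"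
      using meas[of B] by simp
    then have "(LINT a|\<pi> \<omega> u. rate_set Adm q B ?k a) = enn2real (\<integral>\<^sup>+a. ennreal (rate_set Adm q B ?k a) \<partial>\<pi> \<omega> u)"
      using rate(2) by (intro integral_eq_nn_integral) auto
    then show ?thesis
      unfolding rate(1) flow using False by (simp add: inflow_def outflow_def)
  next
    case True
    note rate = ennreal_rate_set(2,4)[OF True]
    have "(\<lambda>a. - rate_set Adm q B ?k a) = (\<lambda>a. enn2real (\<integral>\<^sup>+j. ennreal (off_rate Adm q j ?k a) * indicator (- B) j \<partial>count_space UNIV))"
      using rate by (simp add: rate(1)[symmetric] fun_eq_iff)
    then have "(\<lambda>a. - rate_set Adm q B ?k a) \<in> borel_measurable (\<pi> \<omega> u)"
      using meas[of "- B"] by simp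
    then have "(LINT a|\<pi> \<omega> u. - rate_set Adm q B ?k a) = enn2real (\<integral>\<^sup>+a. ennreal (- rate_set Adm q B ?k a) \<partial>\<pi> \<omega> u)"
      using rate(2) by (intro integral_eq_nn_integral) auto
    then have "- (LINT a|\<pi> \<omega> u. rate_set Adm q B ?k a) = enn2real (\<integral>\<^sup>+j. indicator (- B) j * jump_rate \<omega> u j \<partial>count_space UNIV)"
      unfolding rate(1) flow by simp
    then show ?thesis
      using True by (simp add: inflow_def outflow_def)
  qed
qed

definition drift_integral :: "'s set \<Rightarrow> real \<Rightarrow> real \<Rightarrow> 's path \<Rightarrow> real" where
  "drift_integral B s t \<omega> = (LINT u|positive_time. indicator {s<..t} u * (enn2real (inflow B \<omega> u) - enn2real (outflow B \<omega> u)))"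

lemma set_integral_rate_set:
  assumes "\<omega> \<in> Omega" "0 \<le> s"
  shows "(LINT u:{s..t}|lborel. (LINT a|\<pi> \<omega> u. rate_set Adm q B (\<xi> u \<omega>) a)) = drift_integral B s t \<omega>"
proof -
  have "drift_integral B s t \<omega>
    = (LINT u|lborel. indicator {0<..} u *\<^sub>R (indicator {s<..t} u * (enn2real (inflow B \<omega> u) - enn2real (outflow B \<omega> u))))"
    unfolding drift_integral_def by (rule integral_restrict_space) simp
  also have "\<dots> = (LINT u:{s..t}|lborel. (LINT a|\<pi> \<omega> u. rate_set Adm q B (\<xi> u \<omega>) a))"
    unfolding set_lebesgue_integral_def
  \<comment> \<open>The integrands can differ only on a countable set: at s, which the closed
    interval contains and the half-open one does not, and at the jump times, where left limit and
    state may disagree.\<close>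
  proof (rule integral_discrete_difference[where X="insert s (range (\<lambda>m. enn2real (T m \<omega>)))"])
    fix u assume "u \<notin> insert s (range (\<lambda>m. enn2real (T m \<omega>)))"
    then have u: "u \<noteq> s" "u \<notin> range (\<lambda>m. enn2real (T m \<omega>))"
      by auto
    show "indicator {0<..} u *\<^sub>R (indicator {s<..t} u * (enn2real (inflow B \<omega> u) - enn2real (outflow B \<omega> u)))
      = indicator {s..t} u *\<^sub>R (LINT a|\<pi> \<omega> u. rate_set Adm q B (\<xi> u \<omega>) a)"
    proof (cases "s < u \<and> u \<le> t")
      case True
      then have "0 < u"
        using assms(2) by simp
      then show ?thesis
        using True u integral_rate_set[OF assms(1), of u B] \<xi>_eq_\<xi>_minus[OF assms(1) _ u(2)] by simp
    qed (use u in \<open>auto simp: indicator_def\<close>)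
  qed auto
  finally show ?thesis ..
qed

lemma window_sets:
  assumes "\<Gamma> \<in> sets (G s)" "0 \<le> s" "s < t"
  shows "\<Gamma> \<times> {s<..t} \<in> sets (predictable G)"
proof -
  have "\<Gamma> \<times> {s<..} - Omega \<times> {t<..} \<in> sets (predictable G)"
    using assms predictable_rectangle[of s \<Gamma>] predictable_rectangle[of t Omega] sets.top[of "G t"]
    by (intro sets.Diff) auto
  moreover have "\<Gamma> \<times> {s<..} - Omega \<times> {t<..} = \<Gamma> \<times> {s<..t}"
    using sets.sets_into_space[OF assms(1)] by auto
  ultimately show ?thesis
    by simp
qed

lemma \<xi>_minus_at_jump:
  assumes "\<omega> \<in> Omega" "T (Suc m) \<omega> < \<infinity>"
  shows "\<xi>_minus (enn2real (T (Suc m) \<omega>)) \<omega> = X m \<omega>"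
proof -
  have "T m \<omega> < \<infinity>"
    using assms(2) T_mono[of m "Suc m" \<omega>] by (auto intro: le_less_trans)
  then show ?thesis
    using assms T_less_T_Suc[of \<omega> m] by (intro \<xi>_minus_eq) (auto simp: ennreal_enn2real)
qed

text \<open>The event \<Gamma> belongs to the past of s so that its product with (s,t] is
  predictable. As the left limit at \<open>T (Suc m)\<close> is \<open>X m\<close>, a predictable
  condition on the left limit selects the jumps by the state they leave.\<close>

lemma flow_formula:
  assumes \<Gamma>: "\<Gamma> \<in> sets (G s)" and times: "0 \<le> s" "s < t"
    and D: "{(\<omega>, u). \<omega> \<in> Omega \<and> 0 < u \<and> \<xi>_minus u \<omega> \<in> D} \<in> sets (predictable G)"
  defines "J \<equiv> {x. ennreal s < x \<and> x \<le> ennreal t}"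
  shows "(\<integral>\<^sup>+\<omega>. indicator \<Gamma> \<omega> * (\<Sum>m. indicator J (T (Suc m) \<omega>) *
        (indicator D (X m \<omega>) * indicator (Some ` C) (X (Suc m) \<omega>))) \<partial>M)
    = (\<integral>\<^sup>+\<omega>. indicator \<Gamma> \<omega> * (\<integral>\<^sup>+u. indicator {s<..t} u * (indicator D (\<xi>_minus u \<omega>) *
        (\<integral>\<^sup>+j. indicator C j * jump_rate \<omega> u j \<partial>count_space UNIV)) \<partial>positive_time) \<partial>M)"
proof -
  let ?S = "{(\<omega>, u). \<omega> \<in> Omega \<and> 0 < u \<and> \<xi>_minus u \<omega> \<in> D}"
  let ?Y = "\<lambda>(x, j). indicator (\<Gamma> \<times> {s<..t}) x * indicator ?S x * indicator C j :: ennreal"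
  have "(\<lambda>x. indicator (\<Gamma> \<times> {s<..t}) x * indicator ?S x * indicator C j :: ennreal) \<in> borel_measurable (predictable G)" for j
    using window_sets[OF \<Gamma> times] D by (intro borel_measurable_times_ennreal) auto
  then have "?Y \<in> borel_measurable (predictable G \<Otimes>\<^sub>M count_space UNIV)"
    by (intro measurable_pair_count_space) simp
  note formula = compensator_formula[OF this]
  have \<Gamma>_Omega: "\<Gamma> \<subseteq> Omega"
    using sets.sets_into_space[OF \<Gamma>] by simp
  have "(\<Sum>m. ?Y ((\<omega>, enn2real (T (Suc m) \<omega>)), the (X (Suc m) \<omega>)) * indicator {m. T (Suc m) \<omega> < \<infinity>} m)
      = indicator \<Gamma> \<omega> * (\<Sum>m. indicator J (T (Suc m) \<omega>) * (indicator D (X m \<omega>) * indicator (Some ` C) (X (Suc m) \<omega>)))"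
    if \<omega>: "\<omega> \<in> Omega" for \<omega>
  proof -
    have "?Y ((\<omega>, enn2real (T (Suc m) \<omega>)), the (X (Suc m) \<omega>)) * indicator {m. T (Suc m) \<omega> < \<infinity>} m
      = indicator \<Gamma> \<omega> * (indicator J (T (Suc m) \<omega>) * (indicator D (X m \<omega>) * indicator (Some ` C) (X (Suc m) \<omega>)))" for m
    proof (cases "T (Suc m) \<omega> < \<infinity>")
      case True
      define v where "v = enn2real (T (Suc m) \<omega>)"
      have v: "T (Suc m) \<omega> = ennreal v"
        using True by (simp add: v_def ennreal_enn2real)
      have "0 < T (Suc m) \<omega>"
        using T_strict_mono[OF \<omega>, of 0 "Suc m"] by simp
      then have "0 < v"
        using v by simp
      moreover obtain k where "X (Suc m) \<omega> = Some k"
        using True T_eq_infty_iff[OF \<omega>, of "Suc m"] by (cases "X (Suc m) \<omega>") auto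
      moreover have "T (Suc m) \<omega> \<in> J \<longleftrightarrow> s < v \<and> v \<le> t"
        using \<open>0 < v\<close> times by (auto simp: J_def v ennreal_less_iff)
      ultimately show ?thesis
        using True \<xi>_minus_at_jump[OF \<omega> True] \<omega> by (auto simp: indicator_def v_def[symmetric])
    next
      case False
      \<comment> \<open>J is bounded by the finite time t, so an infinite jump time contributes 0
        here, as it does through the indicator on the other side.\<close>
      then have "T (Suc m) \<omega> \<notin> J"
        by (auto simp: J_def top_unique not_less)
      then show ?thesis
        using False by simp
    qed
    then show ?thesis
      by (simp only: ennreal_suminf_cmult)
  qed
  then have lhs: "(\<integral>\<^sup>+\<omega>. (\<Sum>m. ?Y ((\<omega>, enn2real (T (Suc m) \<omega>)), the (X (Suc m) \<omega>)) * indicator {m. T (Suc m) \<omega> < \<infinity>} m) \<partial>M)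
    = (\<integral>\<^sup>+\<omega>. indicator \<Gamma> \<omega> * (\<Sum>m. indicator J (T (Suc m) \<omega>) * (indicator D (X m \<omega>) * indicator (Some ` C) (X (Suc m) \<omega>))) \<partial>M)"
    by (intro nn_integral_cong) simp
  have "(\<integral>\<^sup>+u. \<integral>\<^sup>+j. ?Y ((\<omega>, u), j) * jump_rate \<omega> u j \<partial>count_space UNIV \<partial>positive_time)
    = indicator \<Gamma> \<omega> * (\<integral>\<^sup>+u. indicator {s<..t} u * (indicator D (\<xi>_minus u \<omega>) *
        (\<integral>\<^sup>+j. indicator C j * jump_rate \<omega> u j \<partial>count_space UNIV)) \<partial>positive_time)"
    if \<omega>: "\<omega> \<in> Omega" for \<omega>
  proof (cases "\<omega> \<in> \<Gamma>")
    case True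
    have "(\<integral>\<^sup>+j. ?Y ((\<omega>, u), j) * jump_rate \<omega> u j \<partial>count_space UNIV)
      = indicator {s<..t} u * (indicator D (\<xi>_minus u \<omega>) * (\<integral>\<^sup>+j. indicator C j * jump_rate \<omega> u j \<partial>count_space UNIV))" for u
      using True \<omega> times by (cases "u \<in> {s<..t} \<and> \<xi>_minus u \<omega> \<in> D") (auto simp: indicator_def)
    then show ?thesis
      using True by simp
  qed simp
  then have "(\<integral>\<^sup>+\<omega>. \<integral>\<^sup>+u. \<integral>\<^sup>+j. ?Y ((\<omega>, u), j) * jump_rate \<omega> u j \<partial>count_space UNIV \<partial>positive_time \<partial>M)
    = (\<integral>\<^sup>+\<omega>. indicator \<Gamma> \<omega> * (\<integral>\<^sup>+u. indicator {s<..t} u * (indicator D (\<xi>_minus u \<omega>) *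
        (\<integral>\<^sup>+j. indicator C j * jump_rate \<omega> u j \<partial>count_space UNIV)) \<partial>positive_time) \<partial>M)"
    by (intro nn_integral_cong) simp
  with formula lhs show ?thesis
    by simp
qed

lemma \<xi>_minus_predictable':
  "{(\<omega>, u). \<omega> \<in> Omega \<and> 0 < u \<and> \<xi>_minus u \<omega> \<in> - Some ` B} \<in> sets (predictable G)"
proof -
  have "{(\<omega>, u). \<omega> \<in> Omega \<and> 0 < u \<and> \<xi>_minus u \<omega> \<in> - Some ` B}
    = Omega \<times> {0<..} - {(\<omega>, u). \<omega> \<in> Omega \<and> 0 < u \<and> \<xi>_minus u \<omega> \<in> Some ` B}"
    by auto
  then show ?thesis
    using predictable_rectangle[of 0 Omega] sets.top[of "G 0"] \<xi>_minus_predictable[of B] by auto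
qed

lemma
  assumes \<Gamma>: "\<Gamma> \<in> sets (G s)" and times: "0 \<le> s" "s < t"
  defines "J \<equiv> {x. ennreal s < x \<and> x \<le> ennreal t}"
  shows inflow_formula: "(\<integral>\<^sup>+\<omega>. indicator \<Gamma> \<omega> * (\<Sum>m. indicator J (T (Suc m) \<omega>) *
        (indicator (- Some ` B) (X m \<omega>) * indicator (Some ` B) (X (Suc m) \<omega>))) \<partial>M)
    = (\<integral>\<^sup>+\<omega>. indicator \<Gamma> \<omega> * (\<integral>\<^sup>+u. indicator {s<..t} u * inflow B \<omega> u \<partial>positive_time) \<partial>M)"
    and outflow_formula: "(\<integral>\<^sup>+\<omega>. indicator \<Gamma> \<omega> * (\<Sum>m. indicator J (T (Suc m) \<omega>) *
        (indicator (Some ` B) (X m \<omega>) * indicator (- Some ` B) (X (Suc m) \<omega>))) \<partial>M)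
    = (\<integral>\<^sup>+\<omega>. indicator \<Gamma> \<omega> * (\<integral>\<^sup>+u. indicator {s<..t} u * outflow B \<omega> u \<partial>positive_time) \<partial>M)"
proof -
  show "(\<integral>\<^sup>+\<omega>. indicator \<Gamma> \<omega> * (\<Sum>m. indicator J (T (Suc m) \<omega>) *
        (indicator (- Some ` B) (X m \<omega>) * indicator (Some ` B) (X (Suc m) \<omega>))) \<partial>M)
    = (\<integral>\<^sup>+\<omega>. indicator \<Gamma> \<omega> * (\<integral>\<^sup>+u. indicator {s<..t} u * inflow B \<omega> u \<partial>positive_time) \<partial>M)"
    unfolding J_def inflow_def by (rule flow_formula[OF \<Gamma> times \<xi>_minus_predictable'])
  \<comment> \<open>\<open>flow_formula\<close> counts jumps into genuine states outside B, whereas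
    the complement taken in the extended state space also contains \<open>None\<close>. A transition
    to \<open>None\<close> has an infinite jump time and lies outside J.\<close>
  have "indicator J (T (Suc m) \<omega>) * (indicator (Some ` B) (X m \<omega>) * indicator (- Some ` B) (X (Suc m) \<omega>))
    = (indicator J (T (Suc m) \<omega>) * (indicator (Some ` B) (X m \<omega>) * indicator (Some ` (- B)) (X (Suc m) \<omega>)) :: ennreal)"
    if "\<omega> \<in> Omega" for \<omega> m
  proof (cases "X (Suc m) \<omega>")
    case None
    then show ?thesis
      using T_eq_infty_iff[OF that, of "Suc m"] by (simp add: J_def top_unique)
  qed (auto simp: indicator_def)
  then have "(\<integral>\<^sup>+\<omega>. indicator \<Gamma> \<omega> * (\<Sum>m. indicator J (T (Suc m) \<omega>) *
        (indicator (Some ` B) (X m \<omega>) * indicator (- Some ` B) (X (Suc m) \<omega>))) \<partial>M)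
    = (\<integral>\<^sup>+\<omega>. indicator \<Gamma> \<omega> * (\<Sum>m. indicator J (T (Suc m) \<omega>) *
        (indicator (Some ` B) (X m \<omega>) * indicator (Some ` (- B)) (X (Suc m) \<omega>))) \<partial>M)"
    by (intro nn_integral_cong) simp
  then show "(\<integral>\<^sup>+\<omega>. indicator \<Gamma> \<omega> * (\<Sum>m. indicator J (T (Suc m) \<omega>) *
        (indicator (Some ` B) (X m \<omega>) * indicator (- Some ` B) (X (Suc m) \<omega>))) \<partial>M)
    = (\<integral>\<^sup>+\<omega>. indicator \<Gamma> \<omega> * (\<integral>\<^sup>+u. indicator {s<..t} u * outflow B \<omega> u \<partial>positive_time) \<partial>M)"
    unfolding J_def outflow_def using flow_formula[OF \<Gamma> times \<xi>_minus_predictable, of B "- B"] by simp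
qed

end

section \<open>The conditional expectation of an increment\<close>

context weighted_ctmdp_process
begin

lemma W_finite: "W k < \<infinity>"
  by (cases k) auto

lemma
  shows inflow_le: "\<forall>\<omega>\<in>Omega. \<forall>u>0. inflow B \<omega> u \<le> ennreal L * W (\<xi>_minus u \<omega>)"
    and outflow_le: "\<forall>\<omega>\<in>Omega. \<forall>u>0. outflow B \<omega> u \<le> ennreal L * W (\<xi>_minus u \<omega>)"
  by (intro ballI allI impI, rule order_trans[OF inflow_le_exit_intensity exit_intensity_le] order_trans[OF outflow_le_exit_intensity exit_intensity_le], assumption+)+

lemma expected_flow_finite:
  assumes f: "\<forall>\<omega>\<in>Omega. \<forall>u>0. f \<omega> u \<le> ennreal L * W (\<xi>_minus u \<omega>)"
  shows "(\<integral>\<^sup>+\<omega>. \<integral>\<^sup>+u. indicator {s<..t} u * f \<omega> u \<partial>positive_time \<partial>M) < \<infinity>"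
proof -
  have meas: "(\<lambda>(\<omega>, u). indicator {..t} u * W (\<xi>_minus u \<omega>)) \<in> borel_measurable (M \<Otimes>\<^sub>M positive_time)"
  proof -
    have "(\<lambda>x. indicator {..t} (snd x) :: ennreal) \<in> borel_measurable (M \<Otimes>\<^sub>M positive_time)"
      by (rule measurable_compose[OF measurable_snd], rule measurable_positive_time) measurable
    then show ?thesis
      using \<xi>_minus_W_measurable unfolding split_beta' by (rule borel_measurable_times_ennreal)
  qed
  have "(\<integral>\<^sup>+\<omega>. \<integral>\<^sup>+u. indicator {s<..t} u * f \<omega> u \<partial>positive_time \<partial>M)
    \<le> (\<integral>\<^sup>+\<omega>. \<integral>\<^sup>+u. ennreal L * (indicator {..t} u * W (\<xi>_minus u \<omega>)) \<partial>positive_time \<partial>M)"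
    using f by (intro nn_integral_mono) (auto simp: space_restrict_space indicator_def)
  also have "\<dots> = (\<integral>\<^sup>+\<omega>. ennreal L * (\<integral>\<^sup>+u. indicator {..t} u * W (\<xi>_minus u \<omega>) \<partial>positive_time) \<partial>M)"
    by (intro nn_integral_cong nn_integral_cmult section_product_measurable[OF meas]) simp
  also have "\<dots> = ennreal L * (\<integral>\<^sup>+\<omega>. \<integral>\<^sup>+u. indicator {..t} u * W (\<xi>_minus u \<omega>) \<partial>positive_time \<partial>M)"
    using nn_integral_positive_time_measurable[OF meas] by (rule nn_integral_cmult)
  also have "\<dots> < \<infinity>"
    using expected_occupation_finite[of t] by (simp add: ennreal_mult_less_top)
  finally show ?thesis .
qed

definition flow_integral :: "('s path \<Rightarrow> real \<Rightarrow> ennreal) \<Rightarrow> real \<Rightarrow> real \<Rightarrow> 's path \<Rightarrow> ennreal" where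
  "flow_integral f s t \<omega> = (\<integral>\<^sup>+u. indicator {s<..t} u * f \<omega> u \<partial>positive_time)"

lemma indicator_interval_measurable [measurable]:
  "(indicator {s<..t::real} :: real \<Rightarrow> ennreal) \<in> borel_measurable positive_time"
  "(indicator {s<..t::real} :: real \<Rightarrow> real) \<in> borel_measurable positive_time"
  by (rule measurable_positive_time, simp)+

lemma flow_integral_measurable:
  assumes "(\<lambda>(\<omega>, u). f \<omega> u) \<in> borel_measurable (M \<Otimes>\<^sub>M positive_time)"
  shows "flow_integral f s t \<in> borel_measurable M"
  unfolding flow_integral_def[abs_def]
proof (rule nn_integral_positive_time_measurable)
  show "(\<lambda>(\<omega>, u). indicator {s<..t} u * f \<omega> u) \<in> borel_measurable (M \<Otimes>\<^sub>M positive_time)"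
    using borel_measurable_times_ennreal[OF measurable_compose[OF measurable_snd indicator_interval_measurable(1)] assms]
    by (simp add: split_beta')
qed

text \<open>The occupation bound makes flow integrals finite almost surely, so passing from
  \<open>ennreal\<close> to real integrals loses nothing there. The rate f itself is finite at every
  positive time because W has finite values.\<close>

lemma flow_integral_finite:
  assumes "(\<lambda>(\<omega>, u). f \<omega> u) \<in> borel_measurable (M \<Otimes>\<^sub>M positive_time)"
    and "\<forall>\<omega>\<in>Omega. \<forall>u>0. f \<omega> u \<le> ennreal L * W (\<xi>_minus u \<omega>)"
  shows "AE \<omega> in M. flow_integral f s t \<omega> < \<infinity>" "integrable M (\<lambda>\<omega>. enn2real (flow_integral f s t \<omega>))"
    "AE \<omega> in M. (LINT u|positive_time. indicator {s<..t} u * enn2real (f \<omega> u)) = enn2real (flow_integral f s t \<omega>)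
      \<and> integrable positive_time (\<lambda>u. indicator {s<..t} u * enn2real (f \<omega> u))"
proof -
  have fin: "(\<integral>\<^sup>+\<omega>. flow_integral f s t \<omega> \<partial>M) < \<infinity>"
    unfolding flow_integral_def using assms(2) by (rule expected_flow_finite)
  note meas = flow_integral_measurable[OF assms(1), of s t]
  show AE: "AE \<omega> in M. flow_integral f s t \<omega> < \<infinity>"
    using nn_integral_noteq_infinite[OF meas] fin by (auto simp: less_top)
  have "(\<integral>\<^sup>+\<omega>. ennreal (enn2real (flow_integral f s t \<omega>)) \<partial>M) = (\<integral>\<^sup>+\<omega>. flow_integral f s t \<omega> \<partial>M)"
    by (intro nn_integral_cong_AE, use AE in eventually_elim) (simp add: ennreal_enn2real)
  then show "integrable M (\<lambda>\<omega>. enn2real (flow_integral f s t \<omega>))"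
    using meas fin by (intro integrableI_nonneg) auto
  show "AE \<omega> in M. (LINT u|positive_time. indicator {s<..t} u * enn2real (f \<omega> u)) = enn2real (flow_integral f s t \<omega>)
      \<and> integrable positive_time (\<lambda>u. indicator {s<..t} u * enn2real (f \<omega> u))"
    using AE AE_space
  proof eventually_elim
    case (elim \<omega>)
    then have \<omega>: "\<omega> \<in> Omega" by simp
    have [measurable]: "(\<lambda>u. f \<omega> u) \<in> borel_measurable positive_time"
      using assms(1) \<omega> by (rule section_product_measurable)
    have "ennreal (indicator {s<..t} u * enn2real (f \<omega> u)) = indicator {s<..t} u * f \<omega> u" if "u \<in> space positive_time" for u
    proof -
      have "ennreal L * W (\<xi>_minus u \<omega>) < \<infinity>"
        using W_finite by (simp add: ennreal_mult_less_top)
      then have "f \<omega> u < \<infinity>"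
        using assms(2) \<omega> that by (auto simp: space_restrict_space intro: le_less_trans)
      then show ?thesis
        by (simp add: indicator_def ennreal_enn2real)
    qed
    then have eq: "(\<integral>\<^sup>+u. ennreal (indicator {s<..t} u * enn2real (f \<omega> u)) \<partial>positive_time) = flow_integral f s t \<omega>"
      unfolding flow_integral_def by (intro nn_integral_cong)
    show ?case
    proof
      show "(LINT u|positive_time. indicator {s<..t} u * enn2real (f \<omega> u)) = enn2real (flow_integral f s t \<omega>)"
        unfolding eq[symmetric] by (intro integral_eq_nn_integral) auto
      show "integrable positive_time (\<lambda>u. indicator {s<..t} u * enn2real (f \<omega> u))"
        using elim(1) eq by (intro integrableI_nonneg) auto
    qed
  qed
qed

lemmas inflow_finite = flow_integral_finite[OF inflow_measurable[of B] inflow_le, of s t] for B s t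
lemmas outflow_finite = flow_integral_finite[OF outflow_measurable[of B] outflow_le, of s t] for B s t

text \<open>The real integral of the difference is split where both flows are integrable over the
  window, which is known only almost surely.\<close>

lemma AE_drift_integral:
  "AE \<omega> in M. drift_integral B s t \<omega>
    = enn2real (flow_integral (inflow B) s t \<omega>) - enn2real (flow_integral (outflow B) s t \<omega>)"
  using inflow_finite(3)[where B=B and s=s and t=t] outflow_finite(3)[where B=B and s=s and t=t]
proof eventually_elim
  case (elim \<omega>)
  then show ?case
    by (simp add: drift_integral_def right_diff_distrib)
qed

lemma drift_integral_measurable [measurable]: "drift_integral B s t \<in> borel_measurable M"
  unfolding drift_integral_def[abs_def]
proof (rule sigma_finite_measure.borel_measurable_lebesgue_integral[OF sigma_finite_positive_time])
  have [measurable]: "(\<lambda>x. indicator {s<..t} (snd x) :: real) \<in> borel_measurable (M \<Otimes>\<^sub>M positive_time)"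
    by (rule measurable_compose[OF measurable_snd indicator_interval_measurable(2)])
  have [measurable]: "(\<lambda>x. inflow B (fst x) (snd x)) \<in> borel_measurable (M \<Otimes>\<^sub>M positive_time)"
    "(\<lambda>x. outflow B (fst x) (snd x)) \<in> borel_measurable (M \<Otimes>\<^sub>M positive_time)"
    using inflow_measurable outflow_measurable by (simp_all add: split_beta')
  show "(\<lambda>(\<omega>, u). indicator {s<..t} u * (enn2real (inflow B \<omega> u) - enn2real (outflow B \<omega> u))) \<in> borel_measurable (M \<Otimes>\<^sub>M positive_time)"
    unfolding split_beta' by measurable
qed

lemma integrable_drift_integral: "integrable M (drift_integral B s t)"
proof (subst integrable_cong_AE)
  show "integrable M (\<lambda>\<omega>. enn2real (flow_integral (inflow B) s t \<omega>) - enn2real (flow_integral (outflow B) s t \<omega>))"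
    by (intro Bochner_Integration.integrable_diff inflow_finite(2) outflow_finite(2))
  then show "(\<lambda>\<omega>. enn2real (flow_integral (inflow B) s t \<omega>) - enn2real (flow_integral (outflow B) s t \<omega>)) \<in> borel_measurable M"
    by (rule borel_measurable_integrable)
qed (use AE_drift_integral in auto)

lemma \<xi>_event_measurable: "0 \<le> r \<Longrightarrow> {\<omega> \<in> Omega. \<xi> r \<omega> \<in> Some ` B} \<in> sets (G r)"
  using \<xi>_in_\<F> sets_\<F>_subset_G by blast

text \<open>The pathwise count of entries and exits is integrated over \<Gamma>, and both counts are
  replaced by their compensators. The identity stays additive, so finiteness of the flows plays its
  part only afterwards.\<close>

lemma balance:
  assumes \<Gamma>: "\<Gamma> \<in> sets (G s)" and times: "0 \<le> s" "s < t"
  shows "(\<integral>\<^sup>+\<omega>. indicator \<Gamma> \<omega> * flow_integral (inflow B) s t \<omega> \<partial>M) + emeasure M (\<Gamma> \<inter> {\<omega> \<in> Omega. \<xi> s \<omega> \<in> Some ` B})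
    = (\<integral>\<^sup>+\<omega>. indicator \<Gamma> \<omega> * flow_integral (outflow B) s t \<omega> \<partial>M) + emeasure M (\<Gamma> \<inter> {\<omega> \<in> Omega. \<xi> t \<omega> \<in> Some ` B})"
proof -
  define J where "J = {x. ennreal s < x \<and> x \<le> ennreal t}"
  define enter where "enter \<omega> = (\<Sum>m. indicator J (T (Suc m) \<omega>) * (indicator (- Some ` B) (X m \<omega>) * indicator (Some ` B) (X (Suc m) \<omega>)) :: ennreal)" for \<omega> :: "'s path"
  define leave where "leave \<omega> = (\<Sum>m. indicator J (T (Suc m) \<omega>) * (indicator (Some ` B) (X m \<omega>) * indicator (- Some ` B) (X (Suc m) \<omega>)) :: ennreal)" for \<omega> :: "'s path"
  have J [measurable]: "J \<in> sets borel"
    unfolding J_def by measurable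
  have X_ind [measurable]: "(\<lambda>\<omega>. indicator A (X m \<omega>) :: ennreal) \<in> borel_measurable M" for A m
    by (rule measurable_compose[OF X_measurable_M]) simp
  have [measurable]: "enter \<in> borel_measurable M" "leave \<in> borel_measurable M"
    unfolding enter_def[abs_def] leave_def[abs_def] by measurable
  have \<Gamma>_M [measurable]: "\<Gamma> \<in> sets M"
    using \<Gamma> sets_G_subset by blast
  have ev [measurable]: "{\<omega> \<in> Omega. \<xi> r \<omega> \<in> Some ` B} \<in> sets M" if "0 \<le> r" for r
    using \<xi>_event_measurable[OF that] sets_G_subset by blast
  have em: "emeasure M (\<Gamma> \<inter> {\<omega> \<in> Omega. \<xi> r \<omega> \<in> Some ` B}) = (\<integral>\<^sup>+\<omega>. indicator (\<Gamma> \<inter> {\<omega> \<in> Omega. \<xi> r \<omega> \<in> Some ` B}) \<omega> \<partial>M)" if "0 \<le> r" for r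
    using ev[OF that] by (intro nn_integral_indicator[symmetric] sets.Int \<Gamma>_M)
  have "(\<integral>\<^sup>+\<omega>. indicator \<Gamma> \<omega> * enter \<omega> + indicator (\<Gamma> \<inter> {\<omega> \<in> Omega. \<xi> s \<omega> \<in> Some ` B}) \<omega> \<partial>M)
    = (\<integral>\<^sup>+\<omega>. indicator \<Gamma> \<omega> * leave \<omega> + indicator (\<Gamma> \<inter> {\<omega> \<in> Omega. \<xi> t \<omega> \<in> Some ` B}) \<omega> \<partial>M)"
  proof (rule nn_integral_cong_AE)
    show "AE \<omega> in M. indicator \<Gamma> \<omega> * enter \<omega> + indicator (\<Gamma> \<inter> {\<omega> \<in> Omega. \<xi> s \<omega> \<in> Some ` B}) \<omega>
      = indicator \<Gamma> \<omega> * leave \<omega> + indicator (\<Gamma> \<inter> {\<omega> \<in> Omega. \<xi> t \<omega> \<in> Some ` B}) \<omega>"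
      using AE_nonexplosive AE_space
    proof eventually_elim
      case (elim \<omega>)
      then have \<omega>: "\<omega> \<in> Omega" by simp
      have *: "indicator (\<Gamma> \<inter> {\<omega> \<in> Omega. \<xi> r \<omega> \<in> Some ` B}) \<omega> = (indicator \<Gamma> \<omega> * indicator (Some ` B) (\<xi> r \<omega>) :: ennreal)" for r
        using \<omega> by (simp add: indicator_def)
      show ?case
        unfolding * distrib_left[symmetric] enter_def leave_def J_def
          jump_count_balance[OF \<omega> elim(1) times] ..
    qed
  qed
  moreover have "(\<integral>\<^sup>+\<omega>. indicator \<Gamma> \<omega> * enter \<omega> + indicator (\<Gamma> \<inter> {\<omega> \<in> Omega. \<xi> s \<omega> \<in> Some ` B}) \<omega> \<partial>M)
    = (\<integral>\<^sup>+\<omega>. indicator \<Gamma> \<omega> * enter \<omega> \<partial>M) + emeasure M (\<Gamma> \<inter> {\<omega> \<in> Omega. \<xi> s \<omega> \<in> Some ` B})"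
    using ev[of s] times em[of s] by (subst nn_integral_add) auto
  moreover have "(\<integral>\<^sup>+\<omega>. indicator \<Gamma> \<omega> * leave \<omega> + indicator (\<Gamma> \<inter> {\<omega> \<in> Omega. \<xi> t \<omega> \<in> Some ` B}) \<omega> \<partial>M)
    = (\<integral>\<^sup>+\<omega>. indicator \<Gamma> \<omega> * leave \<omega> \<partial>M) + emeasure M (\<Gamma> \<inter> {\<omega> \<in> Omega. \<xi> t \<omega> \<in> Some ` B})"
    using ev[of t] times em[of t] by (subst nn_integral_add) auto
  ultimately show ?thesis
    using inflow_formula[OF \<Gamma> times, of B] outflow_formula[OF \<Gamma> times, of B]
    by (simp add: enter_def leave_def J_def flow_integral_def)
qed

lemma set_integral_flow:
  assumes \<Gamma>: "\<Gamma> \<in> sets M"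
    and f: "(\<lambda>(\<omega>, u). f \<omega> u) \<in> borel_measurable (M \<Otimes>\<^sub>M positive_time)"
    "\<forall>\<omega>\<in>Omega. \<forall>u>0. f \<omega> u \<le> ennreal L * W (\<xi>_minus u \<omega>)"
  shows "ennreal (LINT \<omega>:\<Gamma>|M. enn2real (flow_integral f s t \<omega>)) = (\<integral>\<^sup>+\<omega>. indicator \<Gamma> \<omega> * flow_integral f s t \<omega> \<partial>M)"
proof -
  note fin = flow_integral_finite[OF f, of s t]
  have "integrable M (\<lambda>\<omega>. indicator \<Gamma> \<omega> *\<^sub>R enn2real (flow_integral f s t \<omega>))"
    by (intro integrable_mult_indicator \<Gamma> fin(2))
  then have "ennreal (LINT \<omega>:\<Gamma>|M. enn2real (flow_integral f s t \<omega>))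
      = (\<integral>\<^sup>+\<omega>. ennreal (indicator \<Gamma> \<omega> *\<^sub>R enn2real (flow_integral f s t \<omega>)) \<partial>M)"
    unfolding set_lebesgue_integral_def by (intro nn_integral_eq_integral[symmetric]) auto
  also have "\<dots> = (\<integral>\<^sup>+\<omega>. indicator \<Gamma> \<omega> * flow_integral f s t \<omega> \<partial>M)"
    by (rule nn_integral_cong_AE, use fin(1) in eventually_elim) (simp add: indicator_def ennreal_enn2real)
  finally show ?thesis .
qed

text \<open>Both flow integrals have finite expectation, so the balance can be read in the reals and
  the outflow moved across.\<close>

lemma set_integral_increment:
  assumes \<Gamma>: "\<Gamma> \<in> sets (G s)" and times: "0 \<le> s" "s < t"
  shows "(LINT \<omega>:\<Gamma>|M. drift_integral B s t \<omega>) + measure M (\<Gamma> \<inter> {\<omega> \<in> Omega. \<xi> s \<omega> \<in> Some ` B})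
    = measure M (\<Gamma> \<inter> {\<omega> \<in> Omega. \<xi> t \<omega> \<in> Some ` B})"
proof -
  let ?in = "\<lambda>\<omega>. enn2real (flow_integral (inflow B) s t \<omega>)"
  let ?out = "\<lambda>\<omega>. enn2real (flow_integral (outflow B) s t \<omega>)"
  have \<Gamma>_M [measurable]: "\<Gamma> \<in> sets M"
    using \<Gamma> sets_G_subset by blast
  have nonneg: "0 \<le> (LINT \<omega>:\<Gamma>|M. ?in \<omega>)" "0 \<le> (LINT \<omega>:\<Gamma>|M. ?out \<omega>)"
    unfolding set_lebesgue_integral_def by (auto intro!: Bochner_Integration.integral_nonneg)
  have "ennreal ((LINT \<omega>:\<Gamma>|M. ?in \<omega>) + measure M (\<Gamma> \<inter> {\<omega> \<in> Omega. \<xi> s \<omega> \<in> Some ` B}))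
    = ennreal ((LINT \<omega>:\<Gamma>|M. ?out \<omega>) + measure M (\<Gamma> \<inter> {\<omega> \<in> Omega. \<xi> t \<omega> \<in> Some ` B}))"
    using balance[OF \<Gamma> times, of B] nonneg
    by (simp add: ennreal_plus set_integral_flow[OF \<Gamma>_M inflow_measurable inflow_le]
      set_integral_flow[OF \<Gamma>_M outflow_measurable outflow_le] M.emeasure_eq_measure)
  then have "(LINT \<omega>:\<Gamma>|M. ?in \<omega>) + measure M (\<Gamma> \<inter> {\<omega> \<in> Omega. \<xi> s \<omega> \<in> Some ` B})
    = (LINT \<omega>:\<Gamma>|M. ?out \<omega>) + measure M (\<Gamma> \<inter> {\<omega> \<in> Omega. \<xi> t \<omega> \<in> Some ` B})"
    using nonneg by (subst (asm) ennreal_inj) auto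
  moreover have "(LINT \<omega>:\<Gamma>|M. drift_integral B s t \<omega>) = (LINT \<omega>:\<Gamma>|M. ?in \<omega> - ?out \<omega>)"
  proof (rule set_lebesgue_integral_cong_AE)
    show "AE \<omega> \<in> \<Gamma> in M. drift_integral B s t \<omega> = ?in \<omega> - ?out \<omega>"
      using AE_drift_integral[of B s t] by eventually_elim simp
    show "(\<lambda>\<omega>. ?in \<omega> - ?out \<omega>) \<in> borel_measurable M"
      using flow_integral_measurable[OF inflow_measurable] flow_integral_measurable[OF outflow_measurable] by measurable
  qed auto
  moreover have "(LINT \<omega>:\<Gamma>|M. ?in \<omega> - ?out \<omega>) = (LINT \<omega>:\<Gamma>|M. ?in \<omega>) - (LINT \<omega>:\<Gamma>|M. ?out \<omega>)"
  proof (rule set_integral_diff(2))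
    show "set_integrable M \<Gamma> ?in" "set_integrable M \<Gamma> ?out"
      unfolding set_integrable_def
      by (intro integrable_mult_indicator[OF \<Gamma>_M] inflow_finite(2) outflow_finite(2))+
  qed
  ultimately show ?thesis
    by simp
qed

lemma cond_exp_increment:
  assumes times: "0 \<le> s" "s < t"
  shows "AE \<omega> in M. real_cond_exp M (G s) (indicator {\<omega> \<in> Omega. \<xi> t \<omega> \<in> Some ` B}) \<omega>
    = indicator (Some ` B) (\<xi> s \<omega>)
      + real_cond_exp M (G s) (\<lambda>\<omega>. LINT u:{s..t}|lborel. (LINT a|\<pi> \<omega> u. rate_set Adm q B (\<xi> u \<omega>) a)) \<omega>"
proof -
  interpret finite_measure_subalgebra M "G s"
    by unfold_locales (rule subalgebra_G)
  let ?E = "\<lambda>r. {\<omega> \<in> Omega. \<xi> r \<omega> \<in> Some ` B}"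
  let ?Z = "\<lambda>\<omega>. LINT u:{s..t}|lborel. (LINT a|\<pi> \<omega> u. rate_set Adm q B (\<xi> u \<omega>) a)"
  let ?C = "real_cond_exp M (G s) (drift_integral B s t)"
  have E_s: "?E s \<in> sets (G s)"
    using times by (intro \<xi>_event_measurable) auto
  have E_M: "?E s \<in> sets M" "?E t \<in> sets M"
    using \<xi>_event_measurable[of s B] \<xi>_event_measurable[of t B] times sets_G_subset by auto
  have "AE \<omega> in M. real_cond_exp M (G s) (indicator (?E t)) \<omega> = indicator (?E s) \<omega> + ?C \<omega>"
  \<comment> \<open>The right side is integrable and measurable for \<open>G s\<close>, so it
    suffices to compare integrals over events of \<open>G s\<close>. There \<open>?C\<close> may be
    replaced by \<open>drift_integral\<close>, and \<open>set_integral_increment\<close> is what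
    remains.\<close>
  proof (rule real_cond_exp_charact)
    fix \<Gamma> assume \<Gamma>: "\<Gamma> \<in> sets (G s)"
    then have \<Gamma>_M: "\<Gamma> \<in> sets M"
      using sets_G_subset by blast
    have ind: "(LINT \<omega>:\<Gamma>|M. indicator (?E r) \<omega>) = measure M (\<Gamma> \<inter> ?E r)" if "?E r \<in> sets M" for r
    proof -
      have "(LINT \<omega>:\<Gamma>|M. indicat_real (?E r) \<omega>) = (LINT \<omega>|M. indicat_real (\<Gamma> \<inter> ?E r) \<omega>)"
        unfolding set_lebesgue_integral_def by (intro Bochner_Integration.integral_cong) (auto simp: indicator_def)
      moreover have "\<Gamma> \<inter> ?E r \<inter> Omega = \<Gamma> \<inter> ?E r"
        by blast
      ultimately show ?thesis
        using \<Gamma>_M that by simp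
    qed
    have int: "set_integrable M \<Gamma> (indicator (?E s) :: _ \<Rightarrow> real)" "set_integrable M \<Gamma> ?C"
      unfolding set_integrable_def
      using E_M(1) real_cond_exp_int(1)[OF integrable_drift_integral]
      by (intro integrable_mult_indicator \<Gamma>_M; simp add: M.emeasure_eq_measure)+
    have "(LINT \<omega>:\<Gamma>|M. indicator (?E s) \<omega> + ?C \<omega>) = measure M (\<Gamma> \<inter> ?E s) + (LINT \<omega>:\<Gamma>|M. ?C \<omega>)"
      using set_integral_add(2)[OF int] ind[OF E_M(1)] by simp
    also have "(LINT \<omega>:\<Gamma>|M. ?C \<omega>) = (LINT \<omega>:\<Gamma>|M. drift_integral B s t \<omega>)"
      using real_cond_exp_intA[OF integrable_drift_integral \<Gamma>] by simp
    finally show "(LINT \<omega>:\<Gamma>|M. indicator (?E t) \<omega>) = (LINT \<omega>:\<Gamma>|M. indicator (?E s) \<omega> + ?C \<omega>)"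
      using set_integral_increment[OF \<Gamma> times, of B] ind[OF E_M(2)] by simp
  next
    show "integrable M (indicator (?E t) :: _ \<Rightarrow> real)"
      using E_M by (auto simp: M.emeasure_eq_measure)
    have "integrable M (indicator (?E s) :: _ \<Rightarrow> real)"
      using E_M by (auto simp: M.emeasure_eq_measure)
    then show "integrable M (\<lambda>\<omega>. indicator (?E s) \<omega> + ?C \<omega>)"
      using real_cond_exp_int(1)[OF integrable_drift_integral] by (rule Bochner_Integration.integrable_add)
    show "(\<lambda>\<omega>. indicator (?E s) \<omega> + ?C \<omega>) \<in> borel_measurable (G s)"
      using E_s by measurable
  qed
  moreover have "AE \<omega> in M. ?C \<omega> = real_cond_exp M (G s) ?Z \<omega>"
  \<comment> \<open>The iterated integral in the claim coincides with \<open>drift_integral\<close>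
    on every path, not just almost surely, and this also gives its measurability.\<close>
  proof (rule real_cond_exp_cong)
    have eq: "?Z \<omega> = drift_integral B s t \<omega>" if "\<omega> \<in> space M" for \<omega>
      using that times by (intro set_integral_rate_set) auto
    then show "AE \<omega> in M. drift_integral B s t \<omega> = ?Z \<omega>"
      by (intro AE_I2) simp
    show "?Z \<in> borel_measurable M"
      using drift_integral_measurable by (rule measurable_cong[THEN iffD1, rotated]) (simp add: eq)
  qed simp
  ultimately show ?thesis
    using AE_space
  proof eventually_elim
    case (elim \<omega>)
    then show ?case
      by (simp add: indicator_def)
  qed
qed

end

theorem theorem3p2:
  fixes Adm :: "'s::countable \<Rightarrow> 'a::polish_space set"
    and q :: "'s \<Rightarrow> 's \<Rightarrow> 'a \<Rightarrow> real"
    and w :: "'s \<Rightarrow> real"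
    and \<rho>\<^sub>1 b\<^sub>1 L :: real
    and \<pi> :: "'s path \<Rightarrow> real \<Rightarrow> 'a option measure"
    and P :: "'s path measure"
    and i :: 's and B :: "'s set" and s t :: real
  assumes model: "ctmdp_model Adm q"
    and w_ge_1: "\<And>k. 1 \<le> w k"
    and constants: "0 < \<rho>\<^sub>1" "0 \<le> b\<^sub>1" "0 < L"
    and drift: "\<And>k a. a \<in> Adm k \<Longrightarrow>
          (\<lambda>j. w j * q j k a) summable_on UNIV \<and>
          (\<Sum>\<^sub>\<infinity>j. w j * q j k a) \<le> \<rho>\<^sub>1 * w k + b\<^sub>1"
    and qstar_le: "\<And>k. qstar Adm q k \<le> L * w k"
    and policy: "\<pi> \<in> policies Adm"
    and law: "policy_law Adm q \<pi> (return_pmf i) P"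
    and times: "0 \<le> s" "s < t"
  shows "AE \<omega> in completion P.
      real_cond_exp (completion P) (completed_filtration P s)
        (indicator {\<omega> \<in> Omega. \<xi> t \<omega> \<in> Some ` B}) \<omega>
      = indicator (Some ` B) (\<xi> s \<omega>)
        + real_cond_exp (completion P) (completed_filtration P s)
            (\<lambda>\<omega>. LINT u:{s..t}|lborel. (LINT a|\<pi> \<omega> u. rate_set Adm q B (\<xi> u \<omega>) a)) \<omega>"
proof -
  have "b\<^sub>1 \<le> b\<^sub>1 * w k" for k
    using mult_left_mono[OF w_ge_1[of k] constants(2)] by simp
  then have "(\<lambda>j. w j * q j k a) summable_on UNIV \<and> (\<Sum>\<^sub>\<infinity>j. w j * q j k a) \<le> (\<rho>\<^sub>1 + b\<^sub>1) * w k"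
    if "a \<in> Adm k" for k a
    using drift[OF that] by (smt (verit) distrib_right)
  then interpret weighted_ctmdp_process Adm q \<pi> P i w "\<rho>\<^sub>1 + b\<^sub>1" L
    using model w_ge_1 constants qstar_le policy law
    by (intro weighted_ctmdp_process.intro ctmdp_process.intro ctmdp_process_axioms.intro
        weighted_ctmdp_process_axioms.intro) auto
  show ?thesis
    using times by (rule cond_exp_increment)
qed

end
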